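(* For any graph $G=(V,E)$, \[ \operatorname{codeg}(\mathcal{C}_G)=|V| \qquad\text{and}\qquad \deg h^\ast(\mathcal{C}_G;z)=|E|. \]
   Context: A graph $G=(V,E)$ is a finite undirected graph with vertex set $V$ and a finite multiset $E$ of edges; multiple edges and loops are allowed, and $G$ has no isolated vertices. Let $\mathbb{R}^{V\cup E}$ have standard unit vectors $\mathbf{e}_\alpha$. The cosmological polytope is $\mathcal{C}_G=\mathrm{conv}(\mathbf{e}_i+\mathbf{e}_j-\mathbf{e}_f,\ \mathbf{e}_i-\mathbf{e}_j+\mathbf{e}_f,\ -\mathbf{e}_i+\mathbf{e}_j+\mathbf{e}_f : f\in E \text{ with endpoints } i,j)$ (for a loop, $i=j$), a lattice polytope of dimension $|V|+|E|-1$. For a $d$-dimensional lattice polytope $P\subset\mathbb{R}^N$, $h^\ast(P;z)$ is defined by $1+\sum_{t\ge1}|tP\cap\mathbb{Z}^N|z^t=h^\ast(P;z)/(1-z)^{d+1}$, and the codegree $\operatorname{codeg}(P)$ is the smallest positive integer $t$ such that $tP$ contains a lattice point in its relative interior. *)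

theory Defs
  imports
    "HOL-Analysis.Analysis"
    "HOL-Computational_Algebra.Polynomial_FPS"
    "HOL-Library.Uprod"
begin

(* A graph with vertex set 'v and edge set 'e is given by a map sending each edge to the unordered
   pair of its endpoints: a non-injective map gives multiple edges, and Upair i i a loop.
   A vertex whose only incident edge is a loop is not isolated. *)

definition no_isolated_vertices :: "('e \<Rightarrow> 'v uprod) \<Rightarrow> bool" where
  "no_isolated_vertices ends \<longleftrightarrow> (\<forall>i. \<exists>f. i \<in> set_uprod (ends f))"

definition vertex_vec :: "'v \<Rightarrow> real ^ ('v::finite + 'e::finite)" where
  "vertex_vec i = axis (Inl i) 1"

definition edge_vec :: "'e \<Rightarrow> real ^ ('v::finite + 'e::finite)" where
  "edge_vec f = axis (Inr f) 1"

definition cosmological_polytope ::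
    "('e::finite \<Rightarrow> 'v::finite uprod) \<Rightarrow> (real ^ ('v + 'e)) set" where
  "cosmological_polytope ends = convex hull
     (\<Union>f. \<Union>(i, j) \<in> {(i, j). ends f = Upair i j}.
        {vertex_vec i + vertex_vec j - edge_vec f,
         vertex_vec i - vertex_vec j + edge_vec f,
         - vertex_vec i + vertex_vec j + edge_vec f})"

definition lattice_points :: "(real ^ 'n) set" where
  "lattice_points = {x. \<forall>k. x $ k \<in> \<int>}"

definition dilate :: "nat \<Rightarrow> (real ^ 'n) set \<Rightarrow> (real ^ 'n) set" where
  "dilate t P = (\<lambda>x. real t *\<^sub>R x) ` P"

definition ehrhart_series :: "(real ^ 'n) set \<Rightarrow> real fps" where
  "ehrhart_series P =
     Abs_fps (\<lambda>t. if t = 0 then 1 else real (card (dilate t P \<inter> lattice_points)))"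

(* The exponent is d + 1, where d is the dimension of P. By Ehrhart's and Stanley's theorems a
   polynomial h as below exists for every nonempty lattice polytope P; it is always unique. *)
definition h_star :: "(real ^ 'n) set \<Rightarrow> real poly" where
  "h_star P =
     (THE h. ehrhart_series P = fps_of_poly h / (1 - fps_X) ^ nat (aff_dim P + 1))"

definition codegree :: "(real ^ 'n) set \<Rightarrow> nat" where
  "codegree P = (LEAST t. t > 0 \<and> rel_interior (dilate t P) \<inter> lattice_points \<noteq> {})"

lemma h_star_eqI:
  assumes "ehrhart_series P = fps_of_poly h / (1 - fps_X) ^ nat (aff_dim P + 1)"
  shows "h_star P = h"
  unfolding h_star_def
proof (rule the_equality)
  fix h' :: "real poly"
  let ?D = "(1 - fps_X) ^ nat (aff_dim P + 1) :: real fps"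
  assume h': "ehrhart_series P = fps_of_poly h' / ?D"
  have "fps_nth ?D 0 \<noteq> 0"
    by (simp add: fps_power_zeroth)
  then have unit: "is_unit ?D"
    by simp
  have "fps_of_poly h' = fps_of_poly h' / ?D * ?D"
    using unit by (metis dvd_div_mult_self unit_imp_dvd)
  also have "\<dots> = fps_of_poly h / ?D * ?D"
    using assms h' by simp
  also have "\<dots> = fps_of_poly h"
    using unit by (metis dvd_div_mult_self unit_imp_dvd)
  finally show "h' = h"
    by (simp add: fps_of_poly_eq_iff)
qed (fact assms)

end

theory Submission imports Defs begin

text \<open>
  A point of the cone over the polytope splits into vertex coordinates \<open>x\<close> and edge coordinates \<open>y\<close>.
  An edge with \<open>y\<^sub>f = c \<ge> 0\<close> allows up to \<open>c\<close> units to be moved between its endpoints, and an edge with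
  \<open>y\<^sub>f = -c < 0\<close> consumes \<open>c\<close> units at each of them. Hence lattice points of the cone are described by
  the cut conditions of a flow problem, and submodularity of cuts makes the flow integral.
  Fix the other edge coordinates. Passing from \<open>G - f\<close> to \<open>y\<^sub>f = c > 0\<close> widens every lattice segment in
  direction \<open>e\<^sub>i - e\<^sub>j\<close> by \<open>c\<close> on both sides, and these segments are indexed by the lattice points of the
  contraction \<open>G / f\<close>. Summing over \<open>y\<^sub>f\<close> gives the deletion-contraction rule
  \<open>h\<^sub>G = (1 + z) h\<^bsub>G - f\<^esub> + 2 z h\<^bsub>G / f\<^esub>\<close> (without the last term for a loop), so the numerator
  has nonnegative coefficients and degree \<open>|E|\<close>.
  For the codegree, the vector with \<open>x = 1\<close>, \<open>y = 0\<close> is interior of degree \<open>|V|\<close>; conversely, in an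
  interior lattice point every cut value is at least 1, and merging the vertices along the edges
  with \<open>y\<^sub>f > 0\<close> shows that the degree is at least \<open>|V|\<close>.
\<close>

section \<open>Cut conditions\<close>

text \<open>The facet inequalities of the cone belong to subgraphs. On a fixed vertex set \<open>S\<close>, an edge inside
  \<open>S\<close> contributes \<open>0\<close> or \<open>2 y\<close> depending on whether it lies in the subgraph; the minimum over all
  subgraphs on \<open>S\<close> is one concave condition.\<close>

definition cut_weight :: "'v set \<Rightarrow> 'v \<Rightarrow> 'v \<Rightarrow> 'r::linordered_idom \<Rightarrow> 'r" where
  "cut_weight S i j y = (if i \<in> S \<and> j \<in> S then min 0 (2 * y) else if i \<in> S \<or> j \<in> S then y else 0)"

definition cut_val ::
    "'e set \<Rightarrow> ('e \<Rightarrow> 'v) \<Rightarrow> ('e \<Rightarrow> 'v) \<Rightarrow> ('v \<Rightarrow> 'r) \<Rightarrow> ('e \<Rightarrow> 'r) \<Rightarrow> 'v set \<Rightarrow> 'r::linordered_idom" where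
  "cut_val E a b x y S = sum x S + (\<Sum>f\<in>E. cut_weight S (a f) (b f) (y f))"

text \<open>Zero slack gives the integer points of degree \<open>t\<close> satisfying all cut
  conditions; positive slack models the room that an additional edge provides. The support
  conditions make the points determined by their values on \<open>V\<close> and \<open>E\<close>, so
  that counting is meaningful.\<close>

definition slack_points ::
    "'v set \<Rightarrow> 'e set \<Rightarrow> ('e \<Rightarrow> 'v) \<Rightarrow> ('e \<Rightarrow> 'v) \<Rightarrow> ('v set \<Rightarrow> int) \<Rightarrow> int \<Rightarrow> (('v \<Rightarrow> int) \<times> ('e \<Rightarrow> int)) set" where
  "slack_points V E a b s t = {(x, y). (\<forall>v. v \<notin> V \<longrightarrow> x v = 0) \<and> (\<forall>f. f \<notin> E \<longrightarrow> y f = 0) \<and>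
     (\<forall>S\<subseteq>V. 0 \<le> cut_val E a b x y S + s S) \<and> sum x V + sum y E = t}"

abbreviation cut_points ::
    "'v set \<Rightarrow> 'e set \<Rightarrow> ('e \<Rightarrow> 'v) \<Rightarrow> ('e \<Rightarrow> 'v) \<Rightarrow> int \<Rightarrow> (('v \<Rightarrow> int) \<times> ('e \<Rightarrow> int)) set" where
  "cut_points V E a b \<equiv> slack_points V E a b (\<lambda>S. 0)"

text \<open>For \<open>y \<ge> 0\<close> the weight is \<open>y\<close> times the indicator that
  \<open>S\<close> separates the endpoints, a cut function; for \<open>y < 0\<close> it is
  \<open>y\<close> times the number of endpoints in \<open>S\<close> with multiplicity, which is
  modular.\<close>

lemma cut_weight_submodular:
  "cut_weight (S \<union> T) i j y + cut_weight (S \<inter> T) i j y \<le> cut_weight S i j y + cut_weight T i j y"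
  by (auto simp: cut_weight_def min_def)

lemma cut_val_submodular:
  assumes "finite S" "finite T"
  shows "cut_val E a b x y (S \<union> T) + cut_val E a b x y (S \<inter> T) \<le> cut_val E a b x y S + cut_val E a b x y T"
proof -
  have "(\<Sum>f\<in>E. cut_weight (S \<union> T) (a f) (b f) (y f) + cut_weight (S \<inter> T) (a f) (b f) (y f))
      \<le> (\<Sum>f\<in>E. cut_weight S (a f) (b f) (y f) + cut_weight T (a f) (b f) (y f))"
    by (intro sum_mono cut_weight_submodular)
  then show ?thesis
    using sum.union_inter[OF assms, of x] by (simp add: cut_val_def sum.distrib algebra_simps)
qed

text \<open>At \<open>S = V\<close> an edge of value \<open>y\<close> has weight
  \<open>y - |y|\<close>. The cut condition for \<open>V\<close> thus bounds the sum of the absolute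
  edge values by the degree.\<close>

lemma cut_val_whole:
  fixes y :: "'e \<Rightarrow> 'r::linordered_idom"
  assumes "a ` E \<subseteq> V" "b ` E \<subseteq> V"
  shows "sum x V + sum y E = cut_val E a b x y V + (\<Sum>f\<in>E. \<bar>y f\<bar>)"
proof -
  have "(\<Sum>f\<in>E. cut_weight V (a f) (b f) (y f)) + (\<Sum>f\<in>E. \<bar>y f\<bar>) = sum y E"
    unfolding sum.distrib[symmetric]
    using assms by (intro sum.cong) (auto simp: cut_weight_def min_def)
  then show ?thesis
    by (simp add: cut_val_def algebra_simps)
qed

lemma cut_val_insert:
  assumes "finite E" "f \<notin> E"
  shows "cut_val (insert f E) a b x y S = cut_val E a b x y S + cut_weight S (a f) (b f) (y f)"
  using assms by (simp add: cut_val_def)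

lemma cut_val_upd [simp]: "f \<notin> E \<Longrightarrow> cut_val E a b x (y(f := c)) S = cut_val E a b x y S"
  by (auto simp: cut_val_def intro!: sum.cong)

lemma cut_points_bound:
  assumes "a ` E \<subseteq> V" "b ` E \<subseteq> V" "finite E" "f \<in> E" "(x, y) \<in> cut_points V E a b t"
  shows "\<bar>y f\<bar> \<le> t"
proof -
  have "\<bar>y f\<bar> \<le> (\<Sum>f\<in>E. \<bar>y f\<bar>)"
    using assms by (intro member_le_sum) auto
  moreover have "0 \<le> cut_val E a b x y V"
    using assms by (auto simp: slack_points_def)
  ultimately show ?thesis
    using cut_val_whole[OF assms(1,2), of x y] assms(5) by (auto simp: slack_points_def)
qed

section \<open>Deletion and contraction\<close>

text \<open>Contracting \<open>j\<close> into \<open>i\<close> forgets how \<open>x i + x j\<close> is shared between the two vertices.\<close>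

definition contract :: "'v \<Rightarrow> 'v \<Rightarrow> ('e \<Rightarrow> 'v) \<Rightarrow> 'e \<Rightarrow> 'v" where
  "contract i j a f = (if a f = j then i else a f)"

text \<open>Here \<open>x i\<close> is the value of the merged vertex and \<open>k\<close> is a
  coordinate along the fibre of the contraction.\<close>

definition split_at :: "'v \<Rightarrow> 'v \<Rightarrow> int \<Rightarrow> ('v \<Rightarrow> int) \<Rightarrow> 'v \<Rightarrow> int" where
  "split_at i j k x = x(i := k, j := x i - k)"

text \<open>Since \<open>i\<close> stands for both vertices, a contracted endpoint lies in
  \<open>S - {j}\<close> exactly when the original one lies in \<open>S\<close>.\<close>

lemma cut_weight_contract:
  assumes "i \<in> S \<longleftrightarrow> j \<in> S" "i \<noteq> j"
  shows "cut_weight (S - {j}) (contract i j a f) (contract i j b f) y = cut_weight S (a f) (b f) y"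
  using assms by (auto simp: cut_weight_def contract_def)

lemma sum_split_at:
  assumes "finite S" "i \<noteq> j"
  shows "sum (split_at i j k x) S =
    sum x (S - {i, j}) + (if i \<in> S then k else 0) + (if j \<in> S then x i - k else 0)"
proof -
  have "sum (split_at i j k x) S = sum (split_at i j k x) (S - {i, j}) + sum (split_at i j k x) (S \<inter> {i, j})"
    using assms(1) by (subst sum.union_disjoint[symmetric]) (auto intro!: sum.cong)
  also have "sum (split_at i j k x) (S - {i, j}) = sum x (S - {i, j})"
    by (auto simp: split_at_def intro!: sum.cong)
  also have "sum (split_at i j k x) (S \<inter> {i, j}) = (if i \<in> S then k else 0) + (if j \<in> S then x i - k else 0)"
    using assms(2) by (auto simp: split_at_def Int_insert_right)
  finally show ?thesis by simp
qed

text \<open>Only sets separating \<open>i\<close> from \<open>j\<close> see the share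
  \<open>k\<close>, and they see it linearly; the share 0 serves as reference point.\<close>

lemma cut_val_split_at:
  assumes "finite S" "i \<noteq> j"
  shows "cut_val E a b (split_at i j k x) y S =
    cut_val E a b (split_at i j 0 x) y S + (if i \<in> S then k else 0) - (if j \<in> S then k else 0)"
  using assms by (simp add: cut_val_def sum_split_at)

text \<open>A nonseparating set sees only the sum of the two shares, which is \<open>x i\<close> for
  every \<open>k\<close>.\<close>

lemma cut_val_contract:
  assumes "finite S" "i \<noteq> j" "i \<in> S \<longleftrightarrow> j \<in> S"
  shows "cut_val E (contract i j a) (contract i j b) x y (S - {j}) = cut_val E a b (split_at i j k x) y S"
proof -
  have "sum x (S - {j}) = sum (split_at i j k x) S"
  proof (cases "i \<in> S")
    case True
    then have "sum x (S - {j}) = x i + sum x (S - {j} - {i})"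
      using assms by (intro sum.remove) auto
    then show ?thesis
      using True assms by (simp add: sum_split_at insert_commute flip: Diff_insert)
  next
    case False
    then show ?thesis
      using assms by (simp add: sum_split_at)
  qed
  then show ?thesis
    using assms by (simp add: cut_val_def cut_weight_contract)
qed

text \<open>Sets containing \<open>i\<close> but not \<open>j\<close> bound the share
  \<open>k\<close> from below, sets containing \<open>j\<close> but not \<open>i\<close> from above.
  The tightest bounds are integers.\<close>

definition lower_bound ::
    "'v set \<Rightarrow> 'e set \<Rightarrow> ('e \<Rightarrow> 'v) \<Rightarrow> ('e \<Rightarrow> 'v) \<Rightarrow> 'v \<Rightarrow> 'v \<Rightarrow> ('v \<Rightarrow> int) \<Rightarrow> ('e \<Rightarrow> int) \<Rightarrow> int" where
  "lower_bound V E a b i j x y = Max ((\<lambda>S. - cut_val E a b (split_at i j 0 x) y S) ` {S. S \<subseteq> V \<and> i \<in> S \<and> j \<notin> S})"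

definition upper_bound ::
    "'v set \<Rightarrow> 'e set \<Rightarrow> ('e \<Rightarrow> 'v) \<Rightarrow> ('e \<Rightarrow> 'v) \<Rightarrow> 'v \<Rightarrow> 'v \<Rightarrow> ('v \<Rightarrow> int) \<Rightarrow> ('e \<Rightarrow> int) \<Rightarrow> int" where
  "upper_bound V E a b i j x y = Min ((\<lambda>S. cut_val E a b (split_at i j 0 x) y S) ` {S. S \<subseteq> V \<and> i \<notin> S \<and> j \<in> S})"

text \<open>The slack that an edge of value \<open>c \<ge> 0\<close> between \<open>i\<close> and
  \<open>j\<close> provides; it vanishes identically for a loop.\<close>

definition separation :: "'v \<Rightarrow> 'v \<Rightarrow> int \<Rightarrow> 'v set \<Rightarrow> int" where
  "separation i j c S = (if (i \<in> S) = (j \<in> S) then 0 else c)"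

lemma separation_0 [simp]: "separation i j 0 = (\<lambda>S. 0)"
  by (auto simp: separation_def)

lemma separating_sets:
  assumes "finite V" "i \<in> V" "j \<in> V" "i \<noteq> j"
  shows "finite {S. S \<subseteq> V \<and> i \<in> S \<and> j \<notin> S} \<and> {S. S \<subseteq> V \<and> i \<in> S \<and> j \<notin> S} \<noteq> {}"
    and "finite {S. S \<subseteq> V \<and> i \<notin> S \<and> j \<in> S} \<and> {S. S \<subseteq> V \<and> i \<notin> S \<and> j \<in> S} \<noteq> {}"
proof -
  have "{i} \<in> {S. S \<subseteq> V \<and> i \<in> S \<and> j \<notin> S}" "{j} \<in> {S. S \<subseteq> V \<and> i \<notin> S \<and> j \<in> S}"
    using assms by auto
  then show "finite {S. S \<subseteq> V \<and> i \<in> S \<and> j \<notin> S} \<and> {S. S \<subseteq> V \<and> i \<in> S \<and> j \<notin> S} \<noteq> {}"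
    and "finite {S. S \<subseteq> V \<and> i \<notin> S \<and> j \<in> S} \<and> {S. S \<subseteq> V \<and> i \<notin> S \<and> j \<in> S} \<noteq> {}"
    using assms(1) by auto
qed

context
  fixes V :: "'v set" and E :: "'e set" and a b :: "'e \<Rightarrow> 'v" and i j :: 'v
  assumes fin: "finite V" and ij: "i \<in> V" "j \<in> V" "i \<noteq> j"
begin

text \<open>The sets \<open>S\<close> are sorted by their trace on \<open>{i, j}\<close>:
  nonseparating ones give the conditions of the contraction, the two separating kinds give the ends
  of the interval for \<open>k\<close>, which the slack moves outwards by \<open>c\<close>.\<close>

lemma split_at_mem_iff:
  assumes "\<forall>v. v \<notin> V - {j} \<longrightarrow> x v = 0"
  shows "(split_at i j k x, y) \<in> slack_points V E a b (separation i j c) t \<longleftrightarrow>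
    (x, y) \<in> cut_points (V - {j}) E (contract i j a) (contract i j b) t \<and>
    k \<in> {lower_bound V E a b i j x y - c..upper_bound V E a b i j x y + c}"
proof -
  have fs: "finite S" if "S \<subseteq> V" for S
    using that fin finite_subset by blast
  let ?C = "cut_val E a b (split_at i j 0 x) y"
  have lo: "lower_bound V E a b i j x y - c \<le> k \<longleftrightarrow> (\<forall>S\<subseteq>V. i \<in> S \<and> j \<notin> S \<longrightarrow> - ?C S - c \<le> k)"
  proof -
    have "lower_bound V E a b i j x y - c \<le> k \<longleftrightarrow> lower_bound V E a b i j x y \<le> k + c"
      by auto
    also have "\<dots> \<longleftrightarrow> (\<forall>S\<in>{S. S \<subseteq> V \<and> i \<in> S \<and> j \<notin> S}. - ?C S \<le> k + c)"
      unfolding lower_bound_def using separating_sets(1)[OF fin ij]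
      by (subst Max_le_iff) simp_all
    finally show ?thesis by (auto simp: diff_le_eq)
  qed
  have hi: "k \<le> upper_bound V E a b i j x y + c \<longleftrightarrow> (\<forall>S\<subseteq>V. i \<notin> S \<and> j \<in> S \<longrightarrow> k \<le> ?C S + c)"
  proof -
    have "k \<le> upper_bound V E a b i j x y + c \<longleftrightarrow> k - c \<le> upper_bound V E a b i j x y"
      by auto
    also have "\<dots> \<longleftrightarrow> (\<forall>S\<in>{S. S \<subseteq> V \<and> i \<notin> S \<and> j \<in> S}. k - c \<le> ?C S)"
      unfolding upper_bound_def using separating_sets(2)[OF fin ij]
      by (subst Min_ge_iff) simp_all
    finally show ?thesis by (auto simp: diff_le_eq)
  qed
  have con: "(\<forall>S\<subseteq>V - {j}. 0 \<le> cut_val E (contract i j a) (contract i j b) x y S) \<longleftrightarrow>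
      (\<forall>S\<subseteq>V. (i \<in> S) = (j \<in> S) \<longrightarrow> 0 \<le> ?C S)" (is "?L \<longleftrightarrow> ?R")
  proof
    assume ?L
    show ?R
    proof (intro allI impI)
      fix S assume S: "S \<subseteq> V" "(i \<in> S) = (j \<in> S)"
      then have "S - {j} \<subseteq> V - {j}" by auto
      with S show "0 \<le> ?C S"
        using \<open>?L\<close>[rule_format, of "S - {j}"] cut_val_contract[of S i j E a b x y 0] fs ij by auto
    qed
  next
    assume ?R
    show ?L
    proof (intro allI impI)
      fix S assume S: "S \<subseteq> V - {j}"
      \<comment> \<open>The only nonseparating set with \<open>T - {j} = S\<close>.\<close>
      define T where "T = (if i \<in> S then insert j S else S)"
      have "T \<subseteq> V" "(i \<in> T) = (j \<in> T)" "S = T - {j}"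
        using S ij by (auto simp: T_def)
      then show "0 \<le> cut_val E (contract i j a) (contract i j b) x y S"
        using \<open>?R\<close>[rule_format, of T] cut_val_contract[of T i j E a b x y 0] fs ij by auto
    qed
  qed
  have all: "(\<forall>S\<subseteq>V. 0 \<le> cut_val E a b (split_at i j k x) y S + separation i j c S) \<longleftrightarrow>
     (\<forall>S\<subseteq>V. (i \<in> S) = (j \<in> S) \<longrightarrow> 0 \<le> ?C S) \<and>
     (\<forall>S\<subseteq>V. i \<in> S \<and> j \<notin> S \<longrightarrow> - ?C S - c \<le> k) \<and> (\<forall>S\<subseteq>V. i \<notin> S \<and> j \<in> S \<longrightarrow> k \<le> ?C S + c)"
    (is "(\<forall>S\<subseteq>V. ?P S) \<longleftrightarrow> (\<forall>S\<subseteq>V. ?Q1 S) \<and> (\<forall>S\<subseteq>V. ?Q2 S) \<and> (\<forall>S\<subseteq>V. ?Q3 S)")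
  proof -
    have "?P S \<longleftrightarrow> ?Q1 S \<and> ?Q2 S \<and> ?Q3 S" if "S \<subseteq> V" for S
      using cut_val_split_at[OF fs[OF that] ij(3), of E a b k x y] by (auto simp: separation_def)
    then have "(\<forall>S\<subseteq>V. ?P S) \<longleftrightarrow> (\<forall>S\<subseteq>V. ?Q1 S \<and> ?Q2 S \<and> ?Q3 S)"
      by (intro all_cong1 imp_cong refl) assumption
    then show ?thesis
      by (simp only: imp_conjR all_conj_distrib)
  qed
  have sm: "sum (split_at i j k x) V = sum x (V - {j})"
  proof -
    have "sum x (V - {j}) = x i + sum x (V - {j} - {i})"
      using fin ij by (intro sum.remove) auto
    then show ?thesis
      using ij fin by (simp add: sum_split_at insert_commute flip: Diff_insert)
  qed
  have "\<forall>v. v \<notin> V \<longrightarrow> split_at i j k x v = 0"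
    using assms ij by (auto simp: split_at_def)
  then show ?thesis
    unfolding slack_points_def using all con lo hi sm assms by auto
qed

text \<open>If \<open>S\<close> contains only \<open>i\<close> and \<open>T\<close> only
  \<open>j\<close>, then the union and the intersection do not separate the two, so their cut values
  are nonnegative. Submodularity gives a nonnegative sum of the values at \<open>S\<close> and
  \<open>T\<close>.\<close>

lemma lower_bound_le_upper_bound:
  assumes "(x, y) \<in> cut_points (V - {j}) E (contract i j a) (contract i j b) t"
  shows "lower_bound V E a b i j x y \<le> upper_bound V E a b i j x y"
proof -
  let ?C = "cut_val E a b (split_at i j 0 x) y"
  have nonsep: "0 \<le> ?C S" if "S \<subseteq> V" "(i \<in> S) = (j \<in> S)" for S
  proof -
    have "finite S" using finite_subset[OF that(1) fin] .
    have "S - {j} \<subseteq> V - {j}" using that by auto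
    then have "0 \<le> cut_val E (contract i j a) (contract i j b) x y (S - {j})"
      using assms by (simp add: slack_points_def)
    with \<open>finite S\<close> show ?thesis
      using cut_val_contract[of S i j E a b x y 0] that(2) ij(3) by simp
  qed
  have "\<forall>S\<in>{S. S \<subseteq> V \<and> i \<in> S \<and> j \<notin> S}. \<forall>T\<in>{S. S \<subseteq> V \<and> i \<notin> S \<and> j \<in> S}. - ?C S \<le> ?C T"
  proof (intro ballI)
    fix S T assume "S \<in> {S. S \<subseteq> V \<and> i \<in> S \<and> j \<notin> S}" "T \<in> {S. S \<subseteq> V \<and> i \<notin> S \<and> j \<in> S}"
    then have that: "S \<subseteq> V" "i \<in> S" "j \<notin> S" "T \<subseteq> V" "i \<notin> T" "j \<in> T"
      by auto
    then have "finite S" "finite T" using fin finite_subset by auto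
    then have "?C (S \<union> T) + ?C (S \<inter> T) \<le> ?C S + ?C T"
      by (rule cut_val_submodular)
    moreover have "0 \<le> ?C (S \<union> T)" "0 \<le> ?C (S \<inter> T)"
      using that by (intro nonsep; auto)+
    ultimately show "- ?C S \<le> ?C T" by linarith
  qed
  then show ?thesis
    unfolding lower_bound_def upper_bound_def
    using separating_sets[OF fin ij] by (subst Max_le_iff, simp, simp) (subst Min_ge_iff, auto)
qed

lemma split_at_merge: "split_at i j (x i) (x(i := x i + x j, j := 0)) = x"
  using ij by (auto simp: split_at_def)

text \<open>The contraction map has integer intervals as fibres; the inverse adds \<open>x j\<close>
  to \<open>x i\<close> and remembers the old \<open>x i\<close> as the share.\<close>

lemma bij_betw_split_at:
  "bij_betw (\<lambda>((x, y), k). (split_at i j k x, y))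
    (SIGMA p:cut_points (V - {j}) E (contract i j a) (contract i j b) t.
       {lower_bound V E a b i j (fst p) (snd p) - c..upper_bound V E a b i j (fst p) (snd p) + c})
    (slack_points V E a b (separation i j c) t)"
proof (rule bij_betwI')
  have supp: "\<forall>v. v \<notin> V - {j} \<longrightarrow> x v = 0" if "(x, y) \<in> cut_points (V - {j}) E a' b' t" for x y and a' b' :: "'e \<Rightarrow> 'v"
    using that by (simp add: slack_points_def)
  let ?D = "SIGMA p:cut_points (V - {j}) E (contract i j a) (contract i j b) t.
       {lower_bound V E a b i j (fst p) (snd p) - c..upper_bound V E a b i j (fst p) (snd p) + c}"
  {
    fix p q assume pq: "p \<in> ?D" "q \<in> ?D"
    obtain x y k x' y' k' where xyk: "p = ((x, y), k)" "q = ((x', y'), k')" by (metis surj_pair)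
    have "x j = 0" "x' j = 0"
      using pq by (simp_all add: xyk slack_points_def)
    then have "x = x' \<and> k = k'" if *: "split_at i j k x = split_at i j k' x'"
    proof -
      have k: "k = k'" using fun_cong[OF *, of i] ij by (simp add: split_at_def)
      have "x v = x' v" for v
        using fun_cong[OF *, of v] fun_cong[OF *, of j] k \<open>x j = 0\<close> \<open>x' j = 0\<close> ij
        by (cases "v = i"; cases "v = j") (simp_all add: split_at_def)
      with k show ?thesis by auto
    qed
    then show "((\<lambda>((x, y), k). (split_at i j k x, y)) p = (\<lambda>((x, y), k). (split_at i j k x, y)) q) = (p = q)"
      unfolding xyk by auto
  next
    fix p assume p: "p \<in> ?D"
    obtain x y k where xyk: "p = ((x, y), k)" by (metis surj_pair)
    from p have mem: "(x, y) \<in> cut_points (V - {j}) E (contract i j a) (contract i j b) t"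
      "k \<in> {lower_bound V E a b i j x y - c..upper_bound V E a b i j x y + c}"
      by (simp_all add: xyk)
    then have "(split_at i j k x, y) \<in> slack_points V E a b (separation i j c) t"
      using split_at_mem_iff[OF supp[OF mem(1)]] by blast
    then show "(\<lambda>((x, y), k). (split_at i j k x, y)) p \<in> slack_points V E a b (separation i j c) t"
      by (simp add: xyk)
  next
    fix q assume q: "q \<in> slack_points V E a b (separation i j c) t"
    obtain x y where xy: "q = (x, y)" by fastforce
    let ?x = "x(i := x i + x j, j := 0)"
    have "\<forall>v. v \<notin> V - {j} \<longrightarrow> ?x v = 0"
      using q ij by (auto simp: xy slack_points_def)
    from split_at_mem_iff[where x = ?x, OF this, of "x i" y c t] q
    have "((?x, y), x i) \<in> ?D"
      unfolding xy split_at_merge by simp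
    then show "\<exists>p\<in>?D. q = (\<lambda>((x, y), k). (split_at i j k x, y)) p"
      by (rule rev_bexI) (simp add: xy split_at_merge del: fun_upd_apply)
  }
qed

lemma finite_slack_points:
  assumes "finite (cut_points (V - {j}) E (contract i j a) (contract i j b) t)"
  shows "finite (slack_points V E a b (separation i j c) t)"
  using bij_betw_finite[OF bij_betw_split_at] assms by auto

lemma card_slack_points:
  assumes "finite (cut_points (V - {j}) E (contract i j a) (contract i j b) t)" "0 \<le> c"
  shows "int (card (slack_points V E a b (separation i j c) t)) =
    int (card (cut_points V E a b t)) +
    2 * c * int (card (cut_points (V - {j}) E (contract i j a) (contract i j b) t))"
proof -
  let ?B = "cut_points (V - {j}) E (contract i j a) (contract i j b) t"
  let ?lo = "\<lambda>p. lower_bound V E a b i j (fst p) (snd p)" and ?hi = "\<lambda>p. upper_bound V E a b i j (fst p) (snd p)"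
  have *: "int (card (slack_points V E a b (separation i j c) t)) =
      (\<Sum>p\<in>?B. ?hi p - ?lo p + 1 + 2 * c)" if "0 \<le> c" for c
  proof -
    have 1: "card (slack_points V E a b (separation i j c) t) = (\<Sum>p\<in>?B. card {?lo p - c..?hi p + c})"
      using bij_betw_same_card[OF bij_betw_split_at, of t c] assms(1) by simp
    show ?thesis
      unfolding 1 of_nat_sum
    proof (rule sum.cong[OF refl])
      fix p assume "p \<in> ?B"
      then have "?lo p \<le> ?hi p"
        by (intro lower_bound_le_upper_bound[where t = t]) simp
      then show "int (card {?lo p - c..?hi p + c}) = ?hi p - ?lo p + 1 + 2 * c"
        using that by simp
    qed
  qed
  \<comment> \<open>The case \<open>c = 0\<close> counts \<open>cut_points\<close>; in comparison
    every fibre has gained \<open>2 * c\<close> points.\<close>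
  show ?thesis
    using *[of 0] *[OF assms(2)] by (simp add: sum.distrib)
qed

text \<open>The interval of valid shares is nonempty with integer ends, and \<open>x i\<close> is
  within \<open>c\<close> of it. Clamping \<open>x i\<close> to the interval gives an integral flow
  along one edge.\<close>

lemma slack_points_shift:
  assumes "(x, y) \<in> slack_points V E a b (separation i j c) t" "0 \<le> c"
  obtains k where "\<bar>k\<bar> \<le> c" "(x(i := x i + k, j := x j - k), y) \<in> cut_points V E a b t"
proof -
  let ?x = "x(i := x i + x j, j := 0)"
  let ?l = "lower_bound V E a b i j ?x y" and ?u = "upper_bound V E a b i j ?x y"
  have supp: "\<forall>v. v \<notin> V - {j} \<longrightarrow> ?x v = 0"
    using assms ij by (auto simp: slack_points_def)
  have mem: "(?x, y) \<in> cut_points (V - {j}) E (contract i j a) (contract i j b) t" "x i \<in> {?l - c..?u + c}"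
    using split_at_mem_iff[where x = ?x, OF supp, of "x i" y c t] assms by (simp_all add: split_at_merge)
  define m where "m = max ?l (min ?u (x i))"
  have "?l \<le> ?u"
    using lower_bound_le_upper_bound[OF mem(1)] .
  then have m: "m \<in> {?l..?u}" "\<bar>m - x i\<bar> \<le> c"
    using mem(2) assms(2) by (auto simp: m_def)
  have "split_at i j m ?x = x(i := x i + (m - x i), j := x j - (m - x i))"
    by (auto simp: split_at_def ij)
  then show ?thesis
    using that[of "m - x i"] m split_at_mem_iff[where x = ?x, OF supp, of m y 0 t] mem(1) by simp
qed

end

section \<open>Counting by the value on one edge\<close>

definition nonneg_points :: "'v set \<Rightarrow> int \<Rightarrow> ('v \<Rightarrow> int) set" where
  "nonneg_points V t = {x. (\<forall>v. v \<notin> V \<longrightarrow> x v = 0) \<and> (\<forall>v. 0 \<le> x v) \<and> sum x V = t}"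

lemma bij_betw_nonneg_points_insert:
  assumes "finite V" "v \<notin> V"
  shows "bij_betw (\<lambda>(k, x). x(v := k)) (SIGMA k:{0..t}. nonneg_points V (t - k)) (nonneg_points (insert v V) t)"
proof (rule bij_betw_byWitness[where f' = "\<lambda>x. (x v, x(v := 0))"])
  have [simp]: "(\<Sum>u\<in>V. if u = v then k else x u) = sum x V" for x :: "'a \<Rightarrow> int" and k
    using assms by (intro sum.cong) auto
  have le: "x v \<le> sum x (insert v V)" if "\<forall>u. 0 \<le> x u" for x :: "'a \<Rightarrow> int"
    using that assms by (simp add: sum_nonneg)
  show "\<forall>p\<in>(SIGMA k:{0..t}. nonneg_points V (t - k)). (\<lambda>x. (x v, x(v := 0))) (case p of (k, x) \<Rightarrow> x(v := k)) = p"
    using assms by (auto simp: nonneg_points_def fun_eq_iff)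
  show "\<forall>x\<in>nonneg_points (insert v V) t. (case (x v, x(v := 0)) of (k, x) \<Rightarrow> x(v := k)) = x"
    by auto
  show "(\<lambda>(k, x). x(v := k)) ` (SIGMA k:{0..t}. nonneg_points V (t - k)) \<subseteq> nonneg_points (insert v V) t"
    using assms by (auto simp: nonneg_points_def)
  show "(\<lambda>x. (x v, x(v := 0))) ` nonneg_points (insert v V) t \<subseteq> (SIGMA k:{0..t}. nonneg_points V (t - k))"
    using assms le by (auto simp: nonneg_points_def)
qed

lemma finite_nonneg_points: "finite V \<Longrightarrow> finite (nonneg_points V t)"
proof (induction V arbitrary: t rule: finite_induct)
  case empty
  have "nonneg_points {} t \<subseteq> {\<lambda>v. 0}"
    by (auto simp: nonneg_points_def)
  then show ?case
    using finite_subset by blast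
next
  case (insert v V)
  then show ?case
    using bij_betw_finite[OF bij_betw_nonneg_points_insert[of V v t]] by auto
qed

lemma geometric_fps: "(1 - fps_X) * Abs_fps (\<lambda>n. 1 :: real) = 1"
  by (rule fps_ext) (simp add: left_diff_distrib fps_X_mult_nth split: nat.split)

text \<open>Each vertex contributes a geometric series, because splitting off its value is a Cauchy
  product.\<close>

lemma nonneg_points_gf:
  assumes "finite V"
  shows "Abs_fps (\<lambda>n. real (card (nonneg_points V (int n)))) * (1 - fps_X) ^ card V = 1"
  using assms
proof (induction V rule: finite_induct)
  case empty
  have "nonneg_points {} (int n) = (if n = 0 then {\<lambda>v :: 'a. 0} else {})" for n
    by (auto simp: nonneg_points_def)
  then show ?case
    by (intro fps_ext) (simp add: fps_one_nth)
next
  case (insert v V)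
  let ?F = "\<lambda>V. Abs_fps (\<lambda>n. real (card (nonneg_points V (int n))))"
  have "?F (insert v V) = Abs_fps (\<lambda>n. 1) * ?F V"
  proof (rule fps_ext)
    fix n
    have "card (nonneg_points (insert v V) (int n)) = (\<Sum>k\<in>{0..int n}. card (nonneg_points V (int n - k)))"
      using bij_betw_same_card[OF bij_betw_nonneg_points_insert[OF insert(1,2), of "int n"]]
        finite_nonneg_points[OF insert(1)] by simp
    also have "\<dots> = (\<Sum>k=0..n. card (nonneg_points V (int n - int k)))"
      by (rule sum.reindex_bij_witness[of _ int nat]) auto
    also have "\<dots> = (\<Sum>k=0..n. card (nonneg_points V (int (n - k))))"
      by (intro sum.cong) (auto simp: of_nat_diff)
    finally show "fps_nth (?F (insert v V)) n = fps_nth (Abs_fps (\<lambda>n. 1) * ?F V) n"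
      by (simp add: fps_mult_nth)
  qed
  then have "?F (insert v V) * (1 - fps_X) ^ card (insert v V) =
      ((1 - fps_X) * Abs_fps (\<lambda>n. 1)) * (?F V * (1 - fps_X) ^ card V)"
    using insert(1,2) by (simp add: ac_simps)
  then show ?case
    using insert.IH geometric_fps by simp
qed

text \<open>Without edges the conditions for singletons say \<open>x \<ge> 0\<close> and imply all
  others.\<close>

lemma cut_points_empty:
  assumes "finite V"
  shows "cut_points V {} a b t = (\<lambda>x. (x, \<lambda>f. 0)) ` nonneg_points V t"
proof -
  have "(\<forall>S\<subseteq>V. 0 \<le> sum x S) \<longleftrightarrow> (\<forall>v. 0 \<le> x v)" if "\<forall>v. v \<notin> V \<longrightarrow> x v = 0" for x :: "'a \<Rightarrow> int"
  proof
    assume *: "\<forall>S\<subseteq>V. 0 \<le> sum x S"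
    show "\<forall>v. 0 \<le> x v"
    proof
      fix v
      show "0 \<le> x v"
        using that *[rule_format, of "{v}"] by (cases "v \<in> V") auto
    qed
  qed (auto intro: sum_nonneg)
  then have "(x, y) \<in> cut_points V {} a b t \<longleftrightarrow> y = (\<lambda>f. 0) \<and> x \<in> nonneg_points V t" for x y
    unfolding slack_points_def nonneg_points_def cut_val_def fun_eq_iff mem_Collect_eq case_prod_conv
    by auto
  then show ?thesis
    by auto
qed

section \<open>Adding one edge\<close>

definition shift :: "'v \<Rightarrow> 'v \<Rightarrow> int \<Rightarrow> ('v \<Rightarrow> int) \<Rightarrow> 'v \<Rightarrow> int" where
  "shift i j c x v = x v + (if v = i then c else 0) + (if v = j then c else 0)"

lemma shift_shift [simp]: "shift i j c (shift i j d x) = shift i j (c + d) x"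
  by (auto simp: shift_def)

lemma shift_0 [simp]: "shift i j 0 x = x"
  by (auto simp: shift_def)

lemma sum_shift:
  assumes "finite S"
  shows "sum (shift i j c x) S = sum x S + (if i \<in> S then c else 0) + (if j \<in> S then c else 0)"
  using assms by (simp add: shift_def sum.distrib)

text \<open>The empty set for a loop makes the contraction term drop out, so that loops need no
  separate recursion.\<close>

definition contracted_points ::
    "'v set \<Rightarrow> 'e set \<Rightarrow> ('e \<Rightarrow> 'v) \<Rightarrow> ('e \<Rightarrow> 'v) \<Rightarrow> 'e \<Rightarrow> int \<Rightarrow> (('v \<Rightarrow> int) \<times> ('e \<Rightarrow> int)) set" where
  "contracted_points V E a b f t = (if a f = b f then {} else
     cut_points (V - {b f}) E (contract (a f) (b f) a) (contract (a f) (b f) b) t)"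

context
  fixes V :: "'v set" and E :: "'e set" and a b :: "'e \<Rightarrow> 'v" and f :: 'e
  assumes fin: "finite V" "finite E" and f: "f \<notin> E" "a f \<in> V" "b f \<in> V"
begin

lemma sum_insert_upd: "sum (y(f := k)) (insert f E) = sum y E + (k::int)"
proof -
  have "sum (y(f := k)) E = sum y E"
    using f by (intro sum.cong) auto
  then show ?thesis
    using f fin by simp
qed

text \<open>An edge of value \<open>c \<ge> 0\<close> adds \<open>c\<close> to the cut values of
  exactly the sets that separate its endpoints.\<close>

lemma cut_points_insert_nonneg_iff:
  assumes "0 \<le> c" "y f = 0"
  shows "(x, y(f := c)) \<in> cut_points V (insert f E) a b t \<longleftrightarrow>
    (x, y) \<in> slack_points V E a b (separation (a f) (b f) c) (t - c)"
proof -
  have "cut_weight S (a f) (b f) c = separation (a f) (b f) c S" for S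
    using assms by (auto simp: cut_weight_def separation_def)
  moreover have "(\<forall>g. g \<notin> insert f E \<longrightarrow> (y(f := c)) g = 0) \<longleftrightarrow> (\<forall>g. g \<notin> E \<longrightarrow> y g = 0)"
    using assms f by auto
  moreover have "sum x V + (sum y E + c) = t \<longleftrightarrow> sum x V + sum y E = t - c"
    by auto
  ultimately show ?thesis
    unfolding slack_points_def mem_Collect_eq case_prod_conv sum_insert_upd
      cut_val_insert[OF fin(2) f(1)] cut_val_upd[OF f(1)] fun_upd_same
    by simp
qed

text \<open>The weight of \<open>- c\<close> is modular, a charge of \<open>c\<close> per endpoint
  in \<open>S\<close>, so \<open>shift\<close> absorbs it into \<open>x\<close>, twice at the vertex
  of a loop. \<open>x\<close> loses \<open>2 * c\<close> and the dropped edge value was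
  \<open>- c\<close>, hence the degree falls by \<open>c\<close>.\<close>

lemma cut_points_insert_nonpos_iff:
  assumes "0 \<le> c" "y f = 0"
  shows "(x, y(f := - c)) \<in> cut_points V (insert f E) a b t \<longleftrightarrow>
    (shift (a f) (b f) (- c) x, y) \<in> cut_points V E a b (t - c)"
proof -
  have w: "cut_weight S (a f) (b f) (- c) = (if a f \<in> S then - c else 0) + (if b f \<in> S then - c else 0)" for S
    using assms by (auto simp: cut_weight_def)
  have y: "(\<forall>g. g \<notin> insert f E \<longrightarrow> (y(f := - c)) g = 0) \<longleftrightarrow> (\<forall>g. g \<notin> E \<longrightarrow> y g = 0)"
    using assms f by auto
  have "shift (a f) (b f) (- c) x v = x v" if "v \<notin> V" for v
    using that f by (auto simp: shift_def)
  then have x: "(\<forall>v. v \<notin> V \<longrightarrow> shift (a f) (b f) (- c) x v = 0) \<longleftrightarrow> (\<forall>v. v \<notin> V \<longrightarrow> x v = 0)"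
    by simp
  have "cut_val (insert f E) a b x (y(f := - c)) S = cut_val E a b (shift (a f) (b f) (- c) x) y S" if "S \<subseteq> V" for S
    using finite_subset[OF that fin(1)] w[of S] f fin by (simp add: cut_val_insert) (simp add: cut_val_def sum_shift)
  moreover have "sum x V + sum (y(f := - c)) (insert f E) = t \<longleftrightarrow>
      sum (shift (a f) (b f) (- c) x) V + sum y E = t - c"
    using fin f by (simp add: sum_insert_upd sum_shift del: fun_upd_apply sum.insert) linarith
  ultimately show ?thesis
    unfolding slack_points_def mem_Collect_eq case_prod_conv x y by simp
qed

lemma bij_betw_fibre_nonneg:
  assumes "0 \<le> c"
  shows "bij_betw (\<lambda>(x, y). (x, y(f := c))) (slack_points V E a b (separation (a f) (b f) c) (t - c))
    {p \<in> cut_points V (insert f E) a b t. snd p f = c}" (is "bij_betw _ ?A ?B")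
proof (rule bij_betw_byWitness[where f' = "\<lambda>(x, y). (x, y(f := 0))"])
  have *: "y f = 0" if "(x, y) \<in> ?A" for x y
    using that f by (auto simp: slack_points_def)
  show "\<forall>p\<in>?A. (case (case p of (x, y) \<Rightarrow> (x, y(f := c))) of (x, y) \<Rightarrow> (x, y(f := 0))) = p"
    using * by auto
  show "\<forall>p\<in>?B. (case (case p of (x, y) \<Rightarrow> (x, y(f := 0))) of (x, y) \<Rightarrow> (x, y(f := c))) = p"
    by auto
  show "(\<lambda>(x, y). (x, y(f := c))) ` ?A \<subseteq> ?B"
    using * cut_points_insert_nonneg_iff[OF assms] by auto
  show "(\<lambda>(x, y). (x, y(f := 0))) ` ?B \<subseteq> ?A"
  proof safe
    fix x y assume "(x, y) \<in> cut_points V (insert f E) a b t" and c: "c = snd (x, y) f"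
    then have "(x, (y(f := 0))(f := c)) \<in> cut_points V (insert f E) a b t"
      by (simp add: fun_upd_idem)
    then show "(x, y(f := 0)) \<in> slack_points V E a b (separation (a f) (b f) (snd (x, y) f)) (t - snd (x, y) f)"
      unfolding c[symmetric] by (subst (asm) cut_points_insert_nonneg_iff[OF assms]) simp_all
  qed
qed

lemma bij_betw_fibre_nonpos:
  assumes "0 \<le> c"
  shows "bij_betw (\<lambda>(x, y). (shift (a f) (b f) c x, y(f := - c))) (cut_points V E a b (t - c))
    {p \<in> cut_points V (insert f E) a b t. snd p f = - c}" (is "bij_betw _ ?A ?B")
proof (rule bij_betw_byWitness[where f' = "\<lambda>(x, y). (shift (a f) (b f) (- c) x, y(f := 0))"])
  have *: "y f = 0" if "(x, y) \<in> ?A" for x y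
    using that f by (auto simp: slack_points_def)
  show "\<forall>p\<in>?A. (case (case p of (x, y) \<Rightarrow> (shift (a f) (b f) c x, y(f := - c))) of
      (x, y) \<Rightarrow> (shift (a f) (b f) (- c) x, y(f := 0))) = p"
    using * by auto
  show "\<forall>p\<in>?B. (case (case p of (x, y) \<Rightarrow> (shift (a f) (b f) (- c) x, y(f := 0))) of
      (x, y) \<Rightarrow> (shift (a f) (b f) c x, y(f := - c))) = p"
    by auto
  show "(\<lambda>(x, y). (shift (a f) (b f) c x, y(f := - c))) ` ?A \<subseteq> ?B"
    using * cut_points_insert_nonpos_iff[OF assms] by auto
  show "(\<lambda>(x, y). (shift (a f) (b f) (- c) x, y(f := 0))) ` ?B \<subseteq> ?A"
  proof safe
    fix x y assume "(x, y) \<in> cut_points V (insert f E) a b t" and c: "snd (x, y) f = - c"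
    then have "(x, (y(f := 0))(f := - c)) \<in> cut_points V (insert f E) a b t"
      by (simp add: fun_upd_idem)
    then show "(shift (a f) (b f) (- c) x, y(f := 0)) \<in> ?A"
      by (subst (asm) cut_points_insert_nonpos_iff[OF assms]) simp_all
  qed
qed

context
  assumes ends: "a ` E \<subseteq> V" "b ` E \<subseteq> V"
    and finite_points: "\<And>t. finite (cut_points V E a b t)" "\<And>t. finite (contracted_points V E a b f t)"
begin

lemma finite_and_card_slack_separation:
  assumes "0 \<le> c"
  shows "finite (slack_points V E a b (separation (a f) (b f) c) t)"
    and "card (slack_points V E a b (separation (a f) (b f) c) t) =
      card (cut_points V E a b t) + 2 * nat c * card (contracted_points V E a b f t)"
proof -
  have "finite (slack_points V E a b (separation (a f) (b f) c) t) \<and>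
      card (slack_points V E a b (separation (a f) (b f) c) t) =
      card (cut_points V E a b t) + 2 * nat c * card (contracted_points V E a b f t)"
  proof (cases "a f = b f")
    case True
    then have "separation (a f) (b f) c = (\<lambda>S. 0)"
      by (auto simp: separation_def)
    with True show ?thesis
      using finite_points by (simp add: contracted_points_def)
  next
    case False
    have *: "contracted_points V E a b f t = cut_points (V - {b f}) E (contract (a f) (b f) a) (contract (a f) (b f) b) t"
      using False by (simp add: contracted_points_def)
    have "int (card (slack_points V E a b (separation (a f) (b f) c) t)) =
        int (card (cut_points V E a b t)) + 2 * c * int (card (contracted_points V E a b f t))"
      using card_slack_points[OF fin(1) f(2,3) False _ assms, where E = E and a = a and b = b and t = t]
        finite_points(2)[of t] unfolding * by simp
    also have "\<dots> = int (card (cut_points V E a b t) + 2 * nat c * card (contracted_points V E a b f t))"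
      using assms by simp
    finally have "card (slack_points V E a b (separation (a f) (b f) c) t) =
        card (cut_points V E a b t) + 2 * nat c * card (contracted_points V E a b f t)"
      by (simp only: of_nat_eq_iff)
    then show ?thesis
      using finite_slack_points[OF fin(1) f(2,3) False] finite_points(2)[of t] unfolding * by auto
  qed
  then show "finite (slack_points V E a b (separation (a f) (b f) c) t)"
    and "card (slack_points V E a b (separation (a f) (b f) c) t) =
      card (cut_points V E a b t) + 2 * nat c * card (contracted_points V E a b f t)"
    by simp_all
qed

text \<open>The bound on absolute edge values leaves finitely many fibres.\<close>

lemma cut_points_insert_fibres:
  "cut_points V (insert f E) a b t = (\<Union>k\<in>{-t..t}. {p \<in> cut_points V (insert f E) a b t. snd p f = k})"
proof -
  have "\<bar>y f\<bar> \<le> t" if "(x, y) \<in> cut_points V (insert f E) a b t" for x y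
    using cut_points_bound[OF _ _ _ _ that] ends f fin by auto
  then show ?thesis by fastforce
qed

text \<open>\<open>nat k\<close> vanishes for negative \<open>k\<close>, so one formula serves both
  signs: only positive edge values produce a contraction term.\<close>

lemma finite_and_card_fibre:
  shows "finite {p \<in> cut_points V (insert f E) a b t. snd p f = k}"
    and "card {p \<in> cut_points V (insert f E) a b t. snd p f = k} =
      card (cut_points V E a b (t - \<bar>k\<bar>)) + 2 * nat k * card (contracted_points V E a b f (t - \<bar>k\<bar>))"
proof -
  have "finite {p \<in> cut_points V (insert f E) a b t. snd p f = k} \<and>
      card {p \<in> cut_points V (insert f E) a b t. snd p f = k} =
      card (cut_points V E a b (t - \<bar>k\<bar>)) + 2 * nat k * card (contracted_points V E a b f (t - \<bar>k\<bar>))"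
  proof (cases "0 \<le> k")
    case True
    then show ?thesis
      using bij_betw_finite[OF bij_betw_fibre_nonneg[OF True]] bij_betw_same_card[OF bij_betw_fibre_nonneg[OF True]]
        finite_and_card_slack_separation[OF True] by (simp add: True)
  next
    case False
    then have "0 \<le> - k" by simp
    from bij_betw_finite[OF bij_betw_fibre_nonpos[OF this, of t]] bij_betw_same_card[OF bij_betw_fibre_nonpos[OF this, of t]]
    show ?thesis
      using finite_points(1) False by simp
  qed
  then show "finite {p \<in> cut_points V (insert f E) a b t. snd p f = k}"
    and "card {p \<in> cut_points V (insert f E) a b t. snd p f = k} =
      card (cut_points V E a b (t - \<bar>k\<bar>)) + 2 * nat k * card (contracted_points V E a b f (t - \<bar>k\<bar>))"
    by simp_all
qed

lemma finite_cut_points_insert: "finite (cut_points V (insert f E) a b t)"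
  by (subst cut_points_insert_fibres) (use finite_and_card_fibre(1) in blast)

text \<open>The edge values \<open>c\<close> and \<open>- c\<close> leave the same degree
  \<open>n - c\<close>, whence the factor 2 for \<open>c > 0\<close>; the contraction term comes
  from the positive value alone.\<close>

lemma card_cut_points_insert:
  "card (cut_points V (insert f E) a b (int n)) =
    (\<Sum>c=0..n. (if c = 0 then 1 else 2) * card (cut_points V E a b (int (n - c))) +
       2 * c * card (contracted_points V E a b f (int (n - c))))"
proof -
  let ?N = "\<lambda>k. card (cut_points V E a b (int n - k))" and ?M = "\<lambda>k. card (contracted_points V E a b f (int n - k))"
  have "card (cut_points V (insert f E) a b (int n)) =
      (\<Sum>k\<in>{-int n..int n}. card {p \<in> cut_points V (insert f E) a b (int n). snd p f = k})"
    by (subst cut_points_insert_fibres, rule card_UN_disjoint) (use finite_and_card_fibre(1) in auto)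
  also have "\<dots> = (\<Sum>k\<in>{-int n..int n}. ?N \<bar>k\<bar> + 2 * nat k * ?M \<bar>k\<bar>)"
    by (simp only: finite_and_card_fibre(2))
  also have "{-int n..int n} = {-int n..-1} \<union> {0..int n}"
    by auto
  also have "(\<Sum>k\<in>\<dots>. ?N \<bar>k\<bar> + 2 * nat k * ?M \<bar>k\<bar>) =
      (\<Sum>k\<in>{-int n..-1}. ?N \<bar>k\<bar>) + (\<Sum>k\<in>{0..int n}. ?N k + 2 * nat k * ?M k)"
    by (subst sum.union_disjoint) auto
  also have "(\<Sum>k\<in>{-int n..-1}. ?N \<bar>k\<bar>) = (\<Sum>c=1..n. ?N (int c))"
    by (rule sum.reindex_bij_witness[of _ "\<lambda>c. - int c" "\<lambda>k. nat (- k)"]) auto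
  \<comment> \<open>A zero term at \<open>c = 0\<close> aligns the index ranges; the edge value 0 is
    counted with the nonnegative ones.\<close>
  also have "(\<Sum>c=1..n. ?N (int c)) = (\<Sum>c=0..n. if c = 0 then 0 else ?N (int c))"
    by (rule sum.mono_neutral_cong_left) auto
  also have "(\<Sum>k\<in>{0..int n}. ?N k + 2 * nat k * ?M k) = (\<Sum>c=0..n. ?N (int c) + 2 * c * ?M (int c))"
    by (rule sum.reindex_bij_witness[of _ int nat]) auto
  finally show ?thesis
    unfolding sum.distrib[symmetric]
    by (simp only:) (intro sum.cong refl; simp add: of_nat_diff)
qed

end

end

section \<open>Generating functions\<close>

text \<open>The numbers 1, 2, 2, ... of edge values with given absolute value have the generating
  function (1 + z) / (1 - z).\<close>

lemma edge_weight_fps: "(1 - fps_X) * Abs_fps (\<lambda>n. if n = 0 then 1 else 2 :: real) = 1 + fps_X"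
proof (rule fps_ext)
  fix n
  show "fps_nth ((1 - fps_X) * Abs_fps (\<lambda>n. if n = 0 then 1 else 2 :: real)) n = fps_nth (1 + fps_X) n"
    by (cases "n \<le> 1") (auto simp: left_diff_distrib fps_X_mult_nth fps_X_nth le_Suc_eq)
qed

text \<open>Handles the widenings by \<open>2 * c\<close>, whose generating function is 2 z / (1 -
  z)^2.\<close>

lemma twice_index_fps: "(1 - fps_X) ^ 2 * Abs_fps (\<lambda>n. 2 * real n) = 2 * fps_X"
proof -
  have "(1 - fps_X) * Abs_fps (\<lambda>n. 2 * real n) = 2 * fps_X * Abs_fps (\<lambda>n. 1)"
    by (rule fps_ext) (auto simp: left_diff_distrib fps_X_mult_nth mult.assoc numeral_fps_const of_nat_diff)
  then have "(1 - fps_X) ^ 2 * Abs_fps (\<lambda>n. 2 * real n) = 2 * fps_X * ((1 - fps_X) * Abs_fps (\<lambda>n. 1))"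
    by (simp add: power2_eq_square ac_simps)
  then show ?thesis
    by (simp add: geometric_fps)
qed

definition cut_series :: "'v set \<Rightarrow> 'e set \<Rightarrow> ('e \<Rightarrow> 'v) \<Rightarrow> ('e \<Rightarrow> 'v) \<Rightarrow> real fps" where
  "cut_series V E a b = Abs_fps (\<lambda>n. real (card (cut_points V E a b (int n))))"

text \<open>Deletion-contraction by induction on the edges; \<open>V\<close>, \<open>a\<close> and
  \<open>b\<close> vary because contraction changes them. Finiteness is carried along since
  \<open>card\<close> of an infinite set is 0, and nonnegativity of all coefficients excludes
  cancellation in the top one.\<close>

theorem cut_series_numerator:
  assumes "finite E" "finite V" "a ` E \<subseteq> V" "b ` E \<subseteq> V"
  shows "(\<forall>t. finite (cut_points V E a b t)) \<and>
    (\<exists>h. fps_of_poly h = cut_series V E a b * (1 - fps_X) ^ (card V + card E) \<and>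
      (\<forall>k. 0 \<le> coeff h k) \<and> 0 < coeff h (card E) \<and> degree h \<le> card E)"
  using assms
proof (induction E arbitrary: V a b rule: finite_induct)
  case empty
  have "card (cut_points V {} a b t) = card (nonneg_points V t)" for t
    unfolding cut_points_empty[OF empty(1)] by (intro card_image) (simp add: inj_on_def)
  then have "cut_series V {} a b * (1 - fps_X) ^ card V = 1"
    using nonneg_points_gf[OF empty(1)] by (simp add: cut_series_def)
  then show ?case
    using empty by (intro conjI exI[of _ 1] allI) (auto simp: cut_points_empty finite_nonneg_points)
next
  case (insert f E)
  have V: "a f \<in> V" "b f \<in> V" "a ` E \<subseteq> V" "b ` E \<subseteq> V"
    using insert.prems by auto
  let ?M = "contracted_points V E a b f"
  obtain h where fin: "\<And>t. finite (cut_points V E a b t)"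
    and h: "fps_of_poly h = cut_series V E a b * (1 - fps_X) ^ (card V + card E)"
      "\<And>k. 0 \<le> coeff h k" "0 < coeff h (card E)" "degree h \<le> card E"
    using insert.IH[OF insert.prems(1) V(3,4)] by blast
  \<comment> \<open>The contraction has one vertex fewer, so at the exponent of \<open>G - f\<close>
    its numerator acquires a factor 1 - z. For a loop the numerator is 0.\<close>
  have "(\<forall>t. finite (?M t)) \<and> (\<exists>h'. fps_of_poly h' * (1 - fps_X) =
      Abs_fps (\<lambda>n. real (card (?M (int n)))) * (1 - fps_X) ^ (card V + card E) \<and>
      (\<forall>k. 0 \<le> coeff h' k) \<and> degree h' \<le> card E)"
  proof (cases "a f = b f")
    case True
    then have "?M = (\<lambda>t. {})"
      using V insert.hyps insert.prems by (auto simp: contracted_points_def)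
    then show ?thesis
      by (intro conjI exI[of _ 0] allI) (auto intro!: fps_ext)
  next
    case False
    then have *: "?M = cut_points (V - {b f}) E (contract (a f) (b f) a) (contract (a f) (b f) b)"
      by (auto simp: contracted_points_def fun_eq_iff)
    have "finite (V - {b f})" "contract (a f) (b f) a ` E \<subseteq> V - {b f}" "contract (a f) (b f) b ` E \<subseteq> V - {b f}"
      using V insert.prems False by (auto simp: contract_def)
    from insert.IH[OF this] obtain h' where "\<And>t. finite (?M t)"
      and h': "fps_of_poly h' = Abs_fps (\<lambda>n. real (card (?M (int n)))) * (1 - fps_X) ^ (card (V - {b f}) + card E)"
        "\<And>k. 0 \<le> coeff h' k" "degree h' \<le> card E"
      unfolding * cut_series_def by blast
    moreover have "card V + card E = Suc (card (V - {b f}) + card E)"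
      using card_Suc_Diff1[OF insert.prems(1) V(2)] by simp
    ultimately show ?thesis
      by (intro conjI exI[of _ h'] allI) (simp_all add: ac_simps)
  qed
  then obtain h' where fin': "\<And>t. finite (?M t)"
    and h': "fps_of_poly h' * (1 - fps_X) = Abs_fps (\<lambda>n. real (card (?M (int n)))) * (1 - fps_X) ^ (card V + card E)"
      "\<And>k. 0 \<le> coeff h' k" "degree h' \<le> card E"
    by blast
  note deps = insert.prems(1) insert.hyps(1,2) V fin fin'
  let ?A = "Abs_fps (\<lambda>n. if n = 0 then 1 else 2 :: real)" and ?B = "Abs_fps (\<lambda>n. 2 * real n)"
  let ?F = "cut_series V E a b" and ?G = "Abs_fps (\<lambda>n. real (card (?M (int n))))"
  let ?X = "1 - fps_X :: real fps" and ?d = "card V + card E"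
  \<comment> \<open>The deletion-contraction rule, with coefficients 1 + z and 2 z.\<close>
  define g where "g = [:1, 1:] * h + [:0, 2:] * h'"
  have "cut_series V (insert f E) a b = ?A * ?F + ?B * ?G"
    by (rule fps_ext)
      (auto simp: cut_series_def card_cut_points_insert[OF deps] fps_mult_nth simp flip: sum.distrib intro!: sum.cong)
  \<comment> \<open>The new edge brings one more factor 1 - z. It clears the denominator of
    \<open>?A\<close>; the second factor needed for \<open>?B\<close> comes with
    \<open>h'\<close>.\<close>
  then have "cut_series V (insert f E) a b * ?X ^ (card V + card (insert f E)) =
      (?X * ?A) * (?F * ?X ^ ?d) + ?X * ?B * (?G * ?X ^ ?d)"
    using insert.hyps by (simp add: algebra_simps)
  also have "\<dots> = (1 + fps_X) * fps_of_poly h + (?X ^ 2 * ?B) * fps_of_poly h'"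
    unfolding h(1)[symmetric] h'(1)[symmetric] edge_weight_fps by (simp add: power2_eq_square ac_simps)
  also have "\<dots> = fps_of_poly g"
    unfolding twice_index_fps g_def
    by (simp add: fps_of_poly_add fps_of_poly_mult fps_of_poly_pCons numeral_fps_const algebra_simps)
  finally have 1: "fps_of_poly g = cut_series V (insert f E) a b * ?X ^ (card V + card (insert f E))" ..
  have coeff_g: "coeff g k = coeff h k + (case k of 0 \<Rightarrow> 0 | Suc j \<Rightarrow> coeff h j + 2 * coeff h' j)" for k
    by (simp add: g_def coeff_pCons split: nat.split)
  have 2: "0 \<le> coeff g k" for k
    using h(2) h'(2) by (auto simp: coeff_g split: nat.split)
  \<comment> \<open>The coefficient of \<open>h\<close> at \<open>card E\<close> is positive and the
    other two contributions are nonnegative.\<close>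
  have 3: "0 < coeff g (card (insert f E))"
    using insert.hyps h(2)[of "Suc (card E)"] h'(2)[of "card E"] h(3) by (simp add: coeff_g)
  have 4: "degree g \<le> card (insert f E)"
  proof (rule degree_le, intro allI impI)
    fix k assume "card (insert f E) < k"
    then show "coeff g k = 0"
      using insert.hyps h(4) h'(3) by (auto simp: coeff_g coeff_eq_0 split: nat.split)
  qed
  show ?case
    using finite_cut_points_insert[OF deps] 1 2 3 4 by blast
qed

section \<open>Concavity of edge weights and the merging bound\<close>

lemma cut_weight_superadditive:
  "cut_weight S i j y + cut_weight S i j y' \<le> cut_weight S i j (y + y')"
  by (auto simp: cut_weight_def min_def)

lemma cut_weight_scale:
  "0 \<le> c \<Longrightarrow> cut_weight S i j (c * y) = c * cut_weight S i j y"
  by (auto simp: cut_weight_def min_def mult_le_0_iff zero_le_mult_iff)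

lemma cut_weight_of_int: "cut_weight S i j (real_of_int y) = real_of_int (cut_weight S i j y)"
  by (auto simp: cut_weight_def min_def)

lemma cut_weight_0 [simp]: "cut_weight S i j 0 = 0"
  by (auto simp: cut_weight_def)

text \<open>An edge inside a block is charged once, in that block; a crossing edge is charged
  \<open>y\<close> in each of its two blocks, which amounts to the same \<open>min 0 (2 * y)\<close>
  as long as \<open>y \<le> 0\<close>.\<close>

lemma sum_cut_weight_fibres:
  fixes p :: "'v::finite \<Rightarrow> 'w" and y :: int
  assumes "p i \<noteq> p j \<Longrightarrow> y \<le> 0"
  shows "(\<Sum>q\<in>range p. cut_weight (p -` {q}) i j y) = min 0 (2 * y)"
proof (cases "p i = p j")
  case True
  then have "(\<Sum>q\<in>range p. cut_weight (p -` {q}) i j y) = (\<Sum>q\<in>range p. if q = p i then min 0 (2 * y) else 0)"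
    by (intro sum.cong) (auto simp: cut_weight_def)
  then show ?thesis by simp
next
  case False
  then have "(\<Sum>q\<in>range p. cut_weight (p -` {q}) i j y) =
      (\<Sum>q\<in>range p. (if q = p i then y else 0) + (if q = p j then y else 0))"
    by (intro sum.cong) (auto simp: cut_weight_def)
  then show ?thesis
    using assms[OF False] by (simp add: sum.distrib)
qed

text \<open>Merging the blocks of a partition along edges of positive weight costs at least one unit of
  weight per merge; once no such edge crosses, every block contributes at least one.\<close>

lemma card_range_le:
  fixes a b :: "'e::finite \<Rightarrow> 'v::finite" and x :: "'v \<Rightarrow> int" and y :: "'e \<Rightarrow> int" and p :: "'v \<Rightarrow> 'w"
  assumes "\<And>S. S \<noteq> {} \<Longrightarrow> 1 \<le> cut_val UNIV a b x y S"
  shows "int (card (range p)) \<le>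
    sum x UNIV + (\<Sum>f\<in>UNIV. min 0 (2 * y f) + (if p (a f) \<noteq> p (b f) then max 0 (y f) else 0))"
    (is "_ \<le> ?W p")
proof (induction "card (range p)" arbitrary: p rule: less_induct)
  case less
  show ?case
  proof (cases "\<exists>f. p (a f) \<noteq> p (b f) \<and> 0 < y f")
    case True
    then obtain f where f: "p (a f) \<noteq> p (b f)" "0 < y f" by blast
    \<comment> \<open>Merges the block of \<open>a f\<close> into that of
      \<open>b f\<close>.\<close>
    define p' where "p' v = (if p v = p (a f) then p (b f) else p v)" for v
    have "range p' = range p - {p (a f)}"
      using f(1) by (auto simp: p'_def)
    then have card: "card (range p) = Suc (card (range p'))"
      by (metis card_Suc_Diff1 finite_imageI finite_class.finite_UNIV rangeI)
    \<comment> \<open>Merging creates no crossing edge, and \<open>f\<close> with its positive value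
      ceases to cross. The values are integers, so the drop is at least 1, matching the loss of one
      block.\<close>
    have "?W p' < ?W p"
      using f by (intro add_strict_left_mono sum_strict_mono_ex1) (auto simp: p'_def intro!: exI[of _ f])
    then show ?thesis
      using less[of p'] card by linarith
  next
    case False
    \<comment> \<open>Blocks are nonempty, hence have cut value at least 1; without positive
      crossing edges these values add up to \<open>?W p\<close>.\<close>
    have "int (card (range p)) \<le> (\<Sum>q\<in>range p. cut_val UNIV a b x y (p -` {q}))"
    proof -
      have "(\<Sum>q\<in>range p. 1) \<le> (\<Sum>q\<in>range p. cut_val UNIV a b x y (p -` {q}))"
        by (intro sum_mono assms) auto
      then show ?thesis by simp
    qed
    also have "\<dots> = (\<Sum>q\<in>range p. sum x (p -` {q})) +
        (\<Sum>f\<in>UNIV. \<Sum>q\<in>range p. cut_weight (p -` {q}) (a f) (b f) (y f))"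
      unfolding cut_val_def sum.distrib by (subst sum.swap) simp
    also have "(\<Sum>q\<in>range p. sum x (p -` {q})) = sum x UNIV"
      using sum.image_gen[of UNIV x p] by (simp add: vimage_def)
    also have "(\<Sum>f\<in>UNIV. \<Sum>q\<in>range p. cut_weight (p -` {q}) (a f) (b f) (y f)) = (\<Sum>f\<in>UNIV. min 0 (2 * y f))"
      using False by (intro sum.cong refl sum_cut_weight_fibres) (meson not_le)
    also have "sum x UNIV + \<dots> = ?W p"
      using False by (intro arg_cong2[where f = plus] sum.cong) (auto simp: max_def)
    finally show ?thesis .
  qed
qed

text \<open>The merging bound is applied to the partition into singletons, where each edge term is
  at most \<open>y f\<close>.\<close>

lemma card_vertices_le:
  fixes a b :: "'e::finite \<Rightarrow> 'v::finite" and x :: "'v \<Rightarrow> int" and y :: "'e \<Rightarrow> int"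
  assumes "\<And>S. S \<noteq> {} \<Longrightarrow> 1 \<le> cut_val UNIV a b x y S"
  shows "int CARD('v) \<le> sum x UNIV + sum y UNIV"
proof -
  have "int CARD('v) \<le>
      sum x UNIV + (\<Sum>f\<in>UNIV. min 0 (2 * y f) + (if a f \<noteq> b f then max 0 (y f) else 0))"
    using card_range_le[where p = "\<lambda>v. v", OF assms] by simp
  also have "\<dots> \<le> sum x UNIV + sum y UNIV"
    by (intro add_left_mono sum_mono) auto
  finally show ?thesis .
qed

section \<open>Lattice points and interior of the polytope\<close>

lemma vertex_vec_nth [simp]:
  "vertex_vec i $ Inl v = (if v = i then 1 else 0)" "vertex_vec i $ Inr f = 0"
  by (auto simp: vertex_vec_def axis_def)

lemma edge_vec_nth [simp]:
  "edge_vec f $ Inl v = 0" "edge_vec f $ Inr g = (if g = f then 1 else 0)"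
  by (auto simp: edge_vec_def axis_def)

lemma vec_sum_eqI:
  fixes z w :: "real ^ ('v::finite + 'e::finite)"
  assumes "\<And>v. z $ Inl v = w $ Inl v" "\<And>f. z $ Inr f = w $ Inr f"
  shows "z = w"
  unfolding vec_eq_iff by (metis assms sumE)

text \<open>The grading of the cone: the polytope lies at height 1 and its \<open>t\<close>-th
  dilate at height \<open>t\<close>.\<close>

definition total :: "real ^ ('v::finite + 'e::finite) \<Rightarrow> real" where
  "total z = (\<Sum>v\<in>UNIV. z $ Inl v) + (\<Sum>f\<in>UNIV. z $ Inr f)"

lemma total_linear [simp]:
  "total (z + w) = total z + total w" "total (z - w) = total z - total w" "total (- z) = - total z"
  "total (c *\<^sub>R z) = c * total z"
  by (auto simp: total_def sum.distrib sum_subtractf sum_negf distrib_left sum_distrib_left)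

lemma sum_vertex_vec_nth [simp]: "(\<Sum>u\<in>UNIV. c u *\<^sub>R vertex_vec u) $ Inl v = c v"
  by (simp add: if_distrib[of "times _"] cong: if_cong)

lemma total_vertex_vec [simp]: "total (vertex_vec i) = 1"
  and total_edge_vec [simp]: "total (edge_vec f) = 1"
  by (auto simp: total_def)

lemma total_inner: "total z = (\<chi> k. 1) \<bullet> z"
proof -
  have "(\<chi> k. 1) \<bullet> z = (\<Sum>k\<in>UNIV <+> UNIV. z $ k)"
    by (simp add: inner_vec_def)
  also have "\<dots> = total z"
    by (subst sum.Plus) (simp_all add: total_def)
  finally show ?thesis ..
qed

definition embed :: "('v \<Rightarrow> int) \<times> ('e \<Rightarrow> int) \<Rightarrow> real ^ ('v::finite + 'e::finite)" where
  "embed p = (\<chi> k. case k of Inl v \<Rightarrow> of_int (fst p v) | Inr f \<Rightarrow> of_int (snd p f))"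

lemma embed_nth [simp]: "embed p $ Inl v = of_int (fst p v)" "embed p $ Inr f = of_int (snd p f)"
  by (auto simp: embed_def)

lemma inj_embed: "inj embed"
proof (rule injI)
  fix p q :: "('a \<Rightarrow> int) \<times> ('b \<Rightarrow> int)"
  assume "embed p = embed q"
  then have "embed p $ k = embed q $ k" for k
    by simp
  from this[of "Inl _"] this[of "Inr _"] show "p = q"
    by (simp add: prod_eq_iff fun_eq_iff)
qed

lemma range_embed: "range embed = lattice_points"
proof
  show "range embed \<subseteq> (lattice_points :: (real ^ ('a + 'b)) set)"
    by (auto simp: lattice_points_def embed_def split: sum.split)
  show "(lattice_points :: (real ^ ('a + 'b)) set) \<subseteq> range embed"
  proof
    fix z :: "real ^ ('a + 'b)"
    assume z: "z \<in> lattice_points"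
    have "z = embed (\<lambda>v. \<lfloor>z $ Inl v\<rfloor>, \<lambda>f. \<lfloor>z $ Inr f\<rfloor>)"
      using z by (intro vec_sum_eqI) (auto simp: lattice_points_def of_int_floor)
    then show "z \<in> range embed" by blast
  qed
qed

lemma total_embed: "total (embed (x, y)) = of_int (sum x UNIV + sum y UNIV)"
  by (simp add: total_def)

section \<open>Cut functionals and the inequalities of the polytope\<close>

definition cut_vec ::
    "('e::finite \<Rightarrow> 'v::finite) \<Rightarrow> ('e \<Rightarrow> 'v) \<Rightarrow> 'v set \<Rightarrow> real ^ ('v + 'e) \<Rightarrow> real" where
  "cut_vec a b S z = cut_val UNIV a b (\<lambda>v. z $ Inl v) (\<lambda>f. z $ Inr f) S"

text \<open>Edge weights are concave and positively homogeneous, being minima of linear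
  functions.\<close>

lemma cut_vec_superadditive: "cut_vec a b S z + cut_vec a b S w \<le> cut_vec a b S (z + w)"
proof -
  have "(\<Sum>f\<in>UNIV. cut_weight S (a f) (b f) (z $ Inr f) + cut_weight S (a f) (b f) (w $ Inr f)) \<le>
      (\<Sum>f\<in>UNIV. cut_weight S (a f) (b f) (z $ Inr f + w $ Inr f))"
    by (intro sum_mono cut_weight_superadditive)
  then show ?thesis
    by (simp add: cut_vec_def cut_val_def sum.distrib)
qed

lemma cut_vec_scale: "0 \<le> c \<Longrightarrow> cut_vec a b S (c *\<^sub>R z) = c * cut_vec a b S z"
  by (simp add: cut_vec_def cut_val_def cut_weight_scale distrib_left sum_distrib_left)

lemma cut_vec_embed: "cut_vec a b S (embed (x, y)) = of_int (cut_val UNIV a b x y S)"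
  by (simp add: cut_vec_def cut_val_def cut_weight_of_int)

text \<open>The free coefficients cover all three kinds of generators and, with
  \<open>\<gamma> = 0\<close>, the vertex vectors.\<close>

lemma cut_vec_generator:
  "cut_vec a b S (\<alpha> *\<^sub>R vertex_vec i + \<beta> *\<^sub>R vertex_vec j + \<gamma> *\<^sub>R edge_vec f) =
    (if i \<in> S then \<alpha> else 0) + (if j \<in> S then \<beta> else 0) + cut_weight S (a f) (b f) \<gamma>"
proof -
  have "(\<Sum>g\<in>UNIV. cut_weight S (a g) (b g) (\<gamma> * (if g = f then 1 else 0))) =
      (\<Sum>g\<in>UNIV. if g = f then cut_weight S (a f) (b f) \<gamma> else 0)"
    by (intro sum.cong) auto
  then show ?thesis
    by (simp add: cut_vec_def cut_val_def sum.distrib flip: sum_distrib_left)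
qed

context
  fixes ends :: "'e::finite \<Rightarrow> 'v::finite uprod" and a b :: "'e \<Rightarrow> 'v"
  assumes ends: "\<And>f. ends f = Upair (a f) (b f)" and no_isolated: "no_isolated_vertices ends"
begin

abbreviation (input) "\<C> \<equiv> cosmological_polytope ends"
abbreviation (input) "\<K> \<equiv> cone hull \<C>"

text \<open>One orientation per edge suffices: exchanging the endpoints fixes the first generator
  and swaps the other two.\<close>

lemma polytope_generators:
  "\<C> = convex hull (\<Union>f. {vertex_vec (a f) + vertex_vec (b f) - edge_vec f,
     vertex_vec (a f) - vertex_vec (b f) + edge_vec f, - vertex_vec (a f) + vertex_vec (b f) + edge_vec f})"
  unfolding cosmological_polytope_def ends
  by (intro arg_cong[where f = "(hull) convex"] SUP_cong refl) (auto simp: add.commute)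

lemma generator_mem:
  "vertex_vec (a f) + vertex_vec (b f) - edge_vec f \<in> \<C>"
  "vertex_vec (a f) - vertex_vec (b f) + edge_vec f \<in> \<C>"
  "- vertex_vec (a f) + vertex_vec (b f) + edge_vec f \<in> \<C>"
  unfolding polytope_generators by (rule hull_inc; blast)+

lemma convex_polytope: "convex \<C>"
  unfolding cosmological_polytope_def by (rule convex_convex_hull)

lemma midpoint_mem: "z \<in> \<C> \<Longrightarrow> w \<in> \<C> \<Longrightarrow> (1 / 2) *\<^sub>R (z + w) \<in> \<C>"
  using convexD[OF convex_polytope, of z w "1 / 2" "1 / 2"] by (simp add: scaleR_add_right)

lemma edge_vec_mem: "edge_vec f \<in> \<C>"
proof -
  have "edge_vec f = (1 / 2) *\<^sub>R ((vertex_vec (a f) - vertex_vec (b f) + edge_vec f) +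
      (- vertex_vec (a f) + vertex_vec (b f) + edge_vec f))"
    by (intro vec_sum_eqI) auto
  then show ?thesis
    using midpoint_mem[OF generator_mem(2,3)] by metis
qed

text \<open>Since \<open>v\<close> is not isolated, it is an endpoint of some edge, and
  \<open>vertex_vec v\<close> is the midpoint of two generators of that edge.\<close>

lemma vertex_vec_mem: "vertex_vec v \<in> \<C>"
proof -
  obtain f where "v \<in> set_uprod (ends f)"
    using no_isolated by (auto simp: no_isolated_vertices_def)
  then consider "v = a f" | "v = b f"
    by (auto simp: ends)
  then show ?thesis
  proof cases
    case 1
    have "vertex_vec (a f) = (1 / 2) *\<^sub>R ((vertex_vec (a f) + vertex_vec (b f) - edge_vec f) +
        (vertex_vec (a f) - vertex_vec (b f) + edge_vec f))"
      by (intro vec_sum_eqI) auto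
    then show ?thesis
      using midpoint_mem[OF generator_mem(1,2)] 1 by metis
  next
    case 2
    have "vertex_vec (b f) = (1 / 2) *\<^sub>R ((vertex_vec (a f) + vertex_vec (b f) - edge_vec f) +
        (- vertex_vec (a f) + vertex_vec (b f) + edge_vec f))"
      by (intro vec_sum_eqI) auto
    then show ?thesis
      using midpoint_mem[OF generator_mem(1,3)] 2 by metis
  qed
qed

lemma polytope_nonempty: "\<C> \<noteq> {}"
  using edge_vec_mem by blast

text \<open>Superadditivity and homogeneity make the solution set convex, so it suffices to check
  the generators.\<close>

lemma polytope_inequalities:
  assumes "z \<in> \<C>"
  shows "0 \<le> cut_vec a b S z" "total z = 1"
proof -
  have "convex {z. 0 \<le> cut_vec a b S z \<and> total z = 1}"
  proof (rule convexI)
    fix z w :: "real ^ ('v + 'e)" and u v :: real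
    assume *: "z \<in> {z. 0 \<le> cut_vec a b S z \<and> total z = 1}" "w \<in> {z. 0 \<le> cut_vec a b S z \<and> total z = 1}"
      "0 \<le> u" "0 \<le> v" "u + v = 1"
    then have "0 \<le> cut_vec a b S (u *\<^sub>R z) + cut_vec a b S (v *\<^sub>R w)"
      by (simp add: cut_vec_scale)
    then show "u *\<^sub>R z + v *\<^sub>R w \<in> {z. 0 \<le> cut_vec a b S z \<and> total z = 1}"
      using * cut_vec_superadditive[of a b S "u *\<^sub>R z" "v *\<^sub>R w"] by auto
  qed
  moreover have "0 \<le> cut_vec a b S (vertex_vec (a f) + vertex_vec (b f) - edge_vec f)"
    "0 \<le> cut_vec a b S (vertex_vec (a f) - vertex_vec (b f) + edge_vec f)"
    "0 \<le> cut_vec a b S (- vertex_vec (a f) + vertex_vec (b f) + edge_vec f)" for f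
    using cut_vec_generator[of a b S 1 "a f" 1 "b f" "-1" f] cut_vec_generator[of a b S 1 "a f" "-1" "b f" 1 f]
      cut_vec_generator[of a b S "-1" "a f" 1 "b f" 1 f]
    by (simp_all add: cut_weight_def)
  ultimately have "\<C> \<subseteq> {z. 0 \<le> cut_vec a b S z \<and> total z = 1}"
    unfolding polytope_generators by (intro hull_minimal) auto
  then show "0 \<le> cut_vec a b S z" "total z = 1"
    using assms by auto
qed

text \<open>The polytope lies in the hyperplane \<open>total z = 1\<close> and contains all standard
  unit vectors.\<close>

lemma aff_dim_polytope: "aff_dim \<C> = int CARD('v) + int CARD('e) - 1"
proof (rule antisym)
  have "\<C> \<subseteq> {z. (\<chi> k. 1) \<bullet> z = 1}"
    using polytope_inequalities(2) by (auto simp: total_inner)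
  then have "aff_dim \<C> \<le> aff_dim {z :: real ^ ('v + 'e). (\<chi> k. 1) \<bullet> z = 1}"
    by (rule aff_dim_subset)
  also have "\<dots> = int CARD('v) + int CARD('e) - 1"
    by (subst aff_dim_hyperplane) (auto simp: vec_eq_iff of_nat_diff Suc_le_eq)
  finally show "aff_dim \<C> \<le> int CARD('v) + int CARD('e) - 1" .
  have "axis k 1 \<in> \<C>" for k :: "'v + 'e"
    using vertex_vec_mem edge_vec_mem by (cases k) (auto simp: vertex_vec_def edge_vec_def)
  then have "Basis \<subseteq> \<C>"
    by (auto simp: Basis_vec_def)
  then have "aff_dim (Basis :: (real ^ ('v + 'e)) set) \<le> aff_dim \<C>"
    by (rule aff_dim_subset)
  moreover have "int (card (Basis :: (real ^ ('v + 'e)) set)) = aff_dim (Basis :: (real ^ ('v + 'e)) set) + 1"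
    by (rule aff_dim_affine_independent) (use affine_dependent_imp_dependent independent_Basis in blast)
  moreover have "card (Basis :: (real ^ ('v + 'e)) set) = CARD('v) + CARD('e)"
    by simp
  ultimately show "int CARD('v) + int CARD('e) - 1 \<le> aff_dim \<C>"
    by linarith
qed

section \<open>The cone over the polytope and its lattice points\<close>

lemma cone_closed:
  shows cone_add: "z \<in> \<K> \<Longrightarrow> w \<in> \<K> \<Longrightarrow> z + w \<in> \<K>"
    and cone_scale: "z \<in> \<K> \<Longrightarrow> 0 \<le> c \<Longrightarrow> c *\<^sub>R z \<in> \<K>"
  using convex_cone[of \<K>] convex_cone_hull[OF convex_polytope] cone_cone_hull[of \<C>] by blast+

lemma cone_inc: "z \<in> \<C> \<Longrightarrow> z \<in> \<K>"
  by (rule hull_inc)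

lemma cone_sum:
  assumes "\<And>i. i \<in> I \<Longrightarrow> g i \<in> \<K>"
  shows "sum g I \<in> \<K>"
proof -
  have "0 \<in> \<K>"
    using cone_scale[OF cone_inc[OF edge_vec_mem], of 0] by simp
  with assms show ?thesis
    by (induction I rule: infinite_finite_induct) (auto intro: cone_add)
qed

text \<open>Points of the polytope have total 1, so \<open>total\<close> recovers the scaling factor
  of a point of the cone.\<close>

lemma mem_dilate_iff: "z \<in> dilate t \<C> \<longleftrightarrow> z \<in> \<K> \<and> total z = real t"
proof
  assume "z \<in> dilate t \<C>"
  then obtain p where "z = real t *\<^sub>R p" "p \<in> \<C>"
    by (auto simp: dilate_def)
  then show "z \<in> \<K> \<and> total z = real t"
    using polytope_inequalities(2) by (simp add: cone_scale cone_inc)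
next
  assume z: "z \<in> \<K> \<and> total z = real t"
  then obtain c p where "z = c *\<^sub>R p" "p \<in> \<C>"
    by (auto simp: cone_hull_expl)
  with z show "z \<in> dilate t \<C>"
    using polytope_inequalities(2)[of p] by (auto simp: dilate_def)
qed

lemma cone_cut_vec:
  assumes "z \<in> \<K>"
  shows "0 \<le> cut_vec a b S z"
  using assms polytope_inequalities(1) by (auto simp: cone_hull_expl cut_vec_scale)

text \<open>Edges are removed one at a time. A negative edge is paid for by its first generator, a
  positive loop by its edge vector, any other edge by an integral transfer between its endpoints;
  without edges a nonnegative combination of vertex vectors remains.\<close>

lemma embed_cut_points_mem_cone:
  assumes "finite E" "(x, y) \<in> cut_points UNIV E a b t"
  shows "embed (x, y) \<in> \<K>"
  using assms
proof (induction E arbitrary: x y t rule: finite_induct)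
  case empty
  then have "(x, y) \<in> (\<lambda>x. (x, \<lambda>f. 0)) ` nonneg_points UNIV t"
    by (simp only: cut_points_empty[OF finite_class.finite_UNIV])
  then have x: "0 \<le> x v" and y: "y = (\<lambda>f. 0)" for v
    by (auto simp: nonneg_points_def)
  have "embed (x, y) = (\<Sum>v\<in>UNIV. of_int (x v) *\<^sub>R vertex_vec v)"
    by (intro vec_sum_eqI) (auto simp: y simp del: sum_component, simp)
  also have "\<dots> \<in> \<K>"
    using x by (intro cone_sum cone_scale cone_inc vertex_vec_mem) simp
  finally show ?case .
next
  case (insert f E)
  define y' where "y' = y(f := 0)"
  have y'f: "y' f = 0" and y: "y = y'(f := y f)"
    by (auto simp: y'_def)
  note deps = finite_class.finite_UNIV insert.hyps(1,2) UNIV_I UNIV_I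
  show ?case
  proof (cases "0 \<le> y f")
    case True
    have "(x, y'(f := y f)) \<in> cut_points UNIV (insert f E) a b t"
      using insert.prems y by simp
    then have slack: "(x, y') \<in> slack_points UNIV E a b (separation (a f) (b f) (y f)) (t - y f)"
      using cut_points_insert_nonneg_iff[where V = UNIV and a = a and b = b and E = E and f = f and y = y', OF deps True y'f] by blast
    show ?thesis
    proof (cases "a f = b f")
      case True
      then have "separation (a f) (b f) (y f) = (\<lambda>S. 0)"
        by (auto simp: separation_def)
      then have "embed (x, y') \<in> \<K>"
        using insert.IH slack by simp
      moreover have "of_int (y f) *\<^sub>R edge_vec f \<in> \<K>"
        using \<open>0 \<le> y f\<close> by (intro cone_scale cone_inc edge_vec_mem) simp
      moreover have "embed (x, y) = embed (x, y') + of_int (y f) *\<^sub>R edge_vec f"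
        by (intro vec_sum_eqI) (auto simp: y'_def)
      ultimately show ?thesis
        by (simp only: cone_add)
    next
      case False
      obtain k where k: "\<bar>k\<bar> \<le> y f"
        "(x(a f := x (a f) + k, b f := x (b f) - k), y') \<in> cut_points UNIV E a b (t - y f)"
        using slack_points_shift[OF finite_class.finite_UNIV UNIV_I UNIV_I False slack \<open>0 \<le> y f\<close>] .
      let ?p = "embed (x(a f := x (a f) + k, b f := x (b f) - k), y')"
      \<comment> \<open>\<open>?q + ?r\<close> has value \<open>- k\<close> at \<open>a f\<close>,
        \<open>k\<close> at \<open>b f\<close> and \<open>y f\<close> at \<open>f\<close>, which
        undoes the transfer. The coefficients are nonnegative because
        \<open>|k| \<le> y f\<close>.\<close>
      let ?q = "((of_int (y f) - of_int k) / 2) *\<^sub>R (vertex_vec (a f) - vertex_vec (b f) + edge_vec f)"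
      let ?r = "((of_int (y f) + of_int k) / 2) *\<^sub>R (- vertex_vec (a f) + vertex_vec (b f) + edge_vec f)"
      have "?p \<in> \<K>"
        using insert.IH k(2) .
      moreover have "?q \<in> \<K>" "?r \<in> \<K>"
        using k(1) by (intro cone_scale cone_inc generator_mem; simp)+
      moreover have "embed (x, y) = ?p + ?q + ?r"
        using False by (intro vec_sum_eqI) (auto simp: y'_def field_simps)
      ultimately show ?thesis
        by (simp only: cone_add)
    qed
  next
    case False
    then have nonneg: "0 \<le> - y f" by simp
    have "(x, y'(f := - (- y f))) \<in> cut_points UNIV (insert f E) a b t"
      using insert.prems y by simp
    then have "(shift (a f) (b f) (- (- y f)) x, y') \<in> cut_points UNIV E a b (t - (- y f))"
      using cut_points_insert_nonpos_iff[where V = UNIV and a = a and b = b and E = E and f = f and y = y', OF deps nonneg y'f] by blast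
    then have "embed (shift (a f) (b f) (- (- y f)) x, y') \<in> \<K>"
      using insert.IH by blast
    moreover have "of_int (- y f) *\<^sub>R (vertex_vec (a f) + vertex_vec (b f) - edge_vec f) \<in> \<K>"
      using nonneg by (intro cone_scale cone_inc generator_mem) simp
    moreover have "embed (x, y) = embed (shift (a f) (b f) (- (- y f)) x, y') +
        of_int (- y f) *\<^sub>R (vertex_vec (a f) + vertex_vec (b f) - edge_vec f)"
      by (intro vec_sum_eqI) (auto simp: y'_def shift_def)
    ultimately show ?thesis
      by (simp only: cone_add)
  qed
qed

text \<open>Necessity comes from the inequalities valid on the cone, sufficiency from the
  decomposition into generators.\<close>

lemma embed_mem_dilate_iff:
  "embed (x, y) \<in> dilate t \<C> \<longleftrightarrow> (x, y) \<in> cut_points UNIV UNIV a b (int t)"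
proof
  assume "embed (x, y) \<in> dilate t \<C>"
  then have cone: "embed (x, y) \<in> \<K>" and "real_of_int (sum x UNIV + sum y UNIV) = real_of_int (int t)"
    by (auto simp: mem_dilate_iff total_embed)
  then have "sum x UNIV + sum y UNIV = int t"
    by (simp only: of_int_eq_iff)
  moreover have "0 \<le> cut_val UNIV a b x y S" for S
    using cone_cut_vec[OF cone, of S] by (simp add: cut_vec_embed)
  ultimately show "(x, y) \<in> cut_points UNIV UNIV a b (int t)"
    by (simp add: slack_points_def)
next
  assume *: "(x, y) \<in> cut_points UNIV UNIV a b (int t)"
  then have "total (embed (x, y)) = real t"
    unfolding total_embed by (simp add: slack_points_def del: of_int_add of_int_sum)
  then show "embed (x, y) \<in> dilate t \<C>"
    using embed_cut_points_mem_cone[OF _ *] by (simp add: mem_dilate_iff)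
qed

lemma card_lattice_points:
  "card (dilate t \<C> \<inter> lattice_points) = card (cut_points UNIV UNIV a b (int t))"
proof -
  have "dilate t \<C> \<inter> lattice_points = embed ` cut_points UNIV UNIV a b (int t)"
    using embed_mem_dilate_iff by (auto simp flip: range_embed)
  then show ?thesis
    using card_image[OF inj_on_subset[OF inj_embed]] by (metis subset_UNIV)
qed

section \<open>Relative interior and codegree\<close>

lemma interior_cut_vec:
  assumes z: "z \<in> rel_interior (dilate t \<C>)" and "0 < t" "S \<noteq> {}"
  shows "0 < cut_vec a b S z"
proof -
  obtain v where v: "v \<in> S" using assms by blast
  have "convex (dilate t \<C>)"
    unfolding dilate_def by (intro convex_scaling convex_polytope)
  moreover have w: "real t *\<^sub>R vertex_vec v \<in> dilate t \<C>"
    using vertex_vec_mem by (auto simp: dilate_def)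
  \<comment> \<open>The segment from \<open>t\<close> times a vertex vector with
    \<open>v \<in> S\<close> can be prolonged beyond \<open>z\<close> to \<open>?q\<close>. Then
    \<open>e *\<^sub>R z\<close> is \<open>?q\<close> plus a positive multiple of that vertex
    vector, whose cut value is positive.\<close>
  ultimately obtain e where e: "1 < e" "(1 - e) *\<^sub>R (real t *\<^sub>R vertex_vec v) + e *\<^sub>R z \<in> dilate t \<C>" (is "?q \<in> _")
    using z convex_rel_interior_iff[of "dilate t \<C>" z] by blast
  have "cut_vec a b S (vertex_vec v) = 1"
    using cut_vec_generator[of a b S 1 v 0 v 0] v by simp
  then have "0 < (e - 1) * real t * cut_vec a b S (vertex_vec v)"
    using e assms by simp
  also have "\<dots> = cut_vec a b S (((e - 1) * real t) *\<^sub>R vertex_vec v)"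
    using e by (simp add: cut_vec_scale)
  also have "\<dots> \<le> cut_vec a b S ?q + cut_vec a b S (((e - 1) * real t) *\<^sub>R vertex_vec v)"
    using e cone_cut_vec by (simp add: mem_dilate_iff)
  also have "\<dots> \<le> cut_vec a b S (?q + ((e - 1) * real t) *\<^sub>R vertex_vec v)"
    by (rule cut_vec_superadditive)
  also have "?q + ((e - 1) * real t) *\<^sub>R vertex_vec v = e *\<^sub>R z"
    by (simp add: algebra_simps)
  finally show ?thesis
    using e by (simp add: cut_vec_scale zero_less_mult_iff)
qed

lemma interior_lattice_point_bound:
  assumes "rel_interior (dilate t \<C>) \<inter> lattice_points \<noteq> {}" "0 < t"
  shows "CARD('v) \<le> t"
proof -
  obtain x y where z: "embed (x, y) \<in> rel_interior (dilate t \<C>)"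
    using assms(1) by (auto simp flip: range_embed)
  \<comment> \<open>Positive integers are at least 1.\<close>
  have "1 \<le> cut_val UNIV a b x y S" if "S \<noteq> {}" for S
    using interior_cut_vec[OF z assms(2) that] by (simp add: cut_vec_embed)
  then have "int CARD('v) \<le> sum x UNIV + sum y UNIV"
    by (rule card_vertices_le)
  also have "(x, y) \<in> cut_points UNIV UNIV a b (int t)"
    using z rel_interior_subset embed_mem_dilate_iff by blast
  then have "sum x UNIV + sum y UNIV = int t"
    by (simp add: slack_points_def)
  finally show ?thesis by simp
qed

text \<open>Positive edge coordinates of \<open>d\<close> are multiples of edge vectors; a negative
  one uses the first generator \<open>m f\<close> times and takes \<open>m f\<close> from each
  endpoint. A vertex thus loses at most \<open>\<epsilon>\<close> through \<open>d\<close> and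
  \<open>2 * \<epsilon>\<close> per edge, so its remainder \<open>r v\<close> is
  nonnegative.\<close>

lemma all_ones_near_mem_cone:
  fixes d :: "real ^ ('v + 'e)"
  assumes "\<And>k. \<bar>d $ k\<bar> \<le> \<epsilon>" "\<epsilon> * (1 + 2 * real CARD('e)) \<le> 1"
  shows "embed (\<lambda>v. 1, \<lambda>f. 0) + d \<in> \<K>"
proof -
  define m where "m f = max 0 (- d $ Inr f)" for f
  define r where "r v = 1 + d $ Inl v - (\<Sum>f\<in>UNIV. m f * ((if v = a f then 1 else 0) + (if v = b f then 1 else 0)))" for v
  have m: "0 \<le> m f" "m f \<le> \<epsilon>" for f
    using assms(1)[of "Inr f"] by (auto simp: m_def)
  have r: "0 \<le> r v" for v
  proof -
    have "(\<Sum>f\<in>UNIV. m f * ((if v = a f then 1 else 0) + (if v = b f then 1 else 0))) \<le> (\<Sum>f\<in>(UNIV :: 'e set). \<epsilon> * 2)"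
      using m order_trans[OF m] by (intro sum_mono mult_mono) auto
    then show ?thesis
      using assms(1)[of "Inl v"] assms(2) by (simp add: r_def algebra_simps)
  qed
  have "embed (\<lambda>v. 1, \<lambda>f. 0) + d = (\<Sum>v\<in>UNIV. r v *\<^sub>R vertex_vec v) +
     (\<Sum>f\<in>UNIV. max 0 (d $ Inr f) *\<^sub>R edge_vec f) +
     (\<Sum>f\<in>UNIV. m f *\<^sub>R (vertex_vec (a f) + vertex_vec (b f) - edge_vec f))"
  proof (intro vec_sum_eqI)
    fix v
    show "(embed (\<lambda>v. 1, \<lambda>f. 0) + d) $ Inl v = ((\<Sum>v\<in>UNIV. r v *\<^sub>R vertex_vec v) +
     (\<Sum>f\<in>UNIV. max 0 (d $ Inr f) *\<^sub>R edge_vec f) +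
     (\<Sum>f\<in>UNIV. m f *\<^sub>R (vertex_vec (a f) + vertex_vec (b f) - edge_vec f))) $ Inl v"
      unfolding vector_add_component sum_vertex_vec_nth by (simp add: r_def)
  next
    fix g
    have m_eq: "(\<Sum>f\<in>UNIV. m f *\<^sub>R (vertex_vec (a f) + vertex_vec (b f) - edge_vec f)) $ Inr g = - m g"
    proof -
      have "(\<Sum>f\<in>UNIV. m f *\<^sub>R (vertex_vec (a f) + vertex_vec (b f) - edge_vec f)) $ Inr g =
          (\<Sum>f\<in>UNIV. if f = g then - m g else 0)"
        unfolding sum_component by (intro sum.cong) auto
      then show ?thesis by simp
    qed
    show "(embed (\<lambda>v. 1, \<lambda>f. 0) + d) $ Inr g = ((\<Sum>v\<in>UNIV. r v *\<^sub>R vertex_vec v) +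
     (\<Sum>f\<in>UNIV. max 0 (d $ Inr f) *\<^sub>R edge_vec f) +
     (\<Sum>f\<in>UNIV. m f *\<^sub>R (vertex_vec (a f) + vertex_vec (b f) - edge_vec f))) $ Inr g"
      unfolding vector_add_component m_eq by (simp add: if_distrib[of "times _"] cong: if_cong) (simp add: m_def)
  qed
  moreover have "(\<Sum>v\<in>UNIV. r v *\<^sub>R vertex_vec v) \<in> \<K>" "(\<Sum>f\<in>UNIV. max 0 (d $ Inr f) *\<^sub>R edge_vec f) \<in> \<K>"
    "(\<Sum>f\<in>UNIV. m f *\<^sub>R (vertex_vec (a f) + vertex_vec (b f) - edge_vec f)) \<in> \<K>"
    using r m by (intro cone_sum cone_scale cone_inc vertex_vec_mem edge_vec_mem generator_mem; simp)+
  ultimately show ?thesis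
    by (simp only: cone_add)
qed

lemma all_ones_interior: "embed (\<lambda>v. 1, \<lambda>f. 0) \<in> rel_interior (dilate CARD('v) \<C>)"
proof -
  let ?u = "embed (\<lambda>v. 1, \<lambda>f. 0) :: real ^ ('v + 'e)"
  have u: "total ?u = real CARD('v)"
    by (simp add: total_embed)
  have "convex (dilate CARD('v) \<C>)" "dilate CARD('v) \<C> \<noteq> {}"
    unfolding dilate_def using polytope_nonempty by (auto intro: convex_scaling convex_polytope)
  moreover have "\<exists>e>1. (1 - e) *\<^sub>R w + e *\<^sub>R ?u \<in> dilate CARD('v) \<C>" if "w \<in> dilate CARD('v) \<C>" for w
  proof -
    \<comment> \<open>Small enough for the perturbation bound with
      \<open>\<epsilon> = \<delta> * norm (?u - w)\<close>; the summand 1 keeps the denominator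
      positive even for \<open>w = ?u\<close>.\<close>
    define \<delta> where "\<delta> = 1 / (1 + (1 + 2 * real CARD('e)) * norm (?u - w))"
    have pos: "0 < 1 + (1 + 2 * real CARD('e)) * norm (?u - w)"
      by (intro add_pos_nonneg mult_nonneg_nonneg) auto
    have "\<delta> > 0"
      using pos by (simp add: \<delta>_def)
    have "?u + \<delta> *\<^sub>R (?u - w) \<in> \<K>"
    proof (rule all_ones_near_mem_cone)
      fix k
      show "\<bar>(\<delta> *\<^sub>R (?u - w)) $ k\<bar> \<le> \<delta> * norm (?u - w)"
        using component_le_norm_cart[of "?u - w" k] \<open>\<delta> > 0\<close> by (simp add: abs_mult)
      show "\<delta> * norm (?u - w) * (1 + 2 * real CARD('e)) \<le> 1"
        using pos by (simp add: \<delta>_def pos_divide_le_eq mult.commute)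
    qed
    moreover have "total (?u + \<delta> *\<^sub>R (?u - w)) = real CARD('v)"
      using that u by (simp add: mem_dilate_iff)
    moreover have "?u + \<delta> *\<^sub>R (?u - w) = (1 - (1 + \<delta>)) *\<^sub>R w + (1 + \<delta>) *\<^sub>R ?u"
      by (simp add: algebra_simps)
    ultimately have "(1 - (1 + \<delta>)) *\<^sub>R w + (1 + \<delta>) *\<^sub>R ?u \<in> dilate CARD('v) \<C>"
      unfolding mem_dilate_iff by simp
    then show ?thesis
      using \<open>\<delta> > 0\<close> by (intro exI[of _ "1 + \<delta>"]) simp
  qed
  ultimately show ?thesis
    using convex_rel_interior_iff[of "dilate CARD('v) \<C>" ?u] by blast
qed

lemma codegree_polytope: "codegree \<C> = CARD('v)"
  unfolding codegree_def
proof (rule Least_equality)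
  have "embed (\<lambda>v. 1, \<lambda>f. 0) \<in> (lattice_points :: (real ^ ('v + 'e)) set)"
    using range_embed by blast
  then show "CARD('v) > 0 \<and> rel_interior (dilate CARD('v) \<C>) \<inter> lattice_points \<noteq> {}"
    using all_ones_interior by auto
qed (use interior_lattice_point_bound in blast)

section \<open>Ehrhart series and degree of its numerator\<close>

lemma ehrhart_series_polytope: "ehrhart_series \<C> = cut_series UNIV UNIV a b"
proof -
  \<comment> \<open>The constant term 1, set by convention in the Ehrhart series, agrees with the
    count of cut points of degree 0.\<close>
  have "dilate 0 \<C> \<inter> lattice_points = {0}"
    using polytope_nonempty by (auto simp: dilate_def lattice_points_def)
  then have "card (cut_points UNIV UNIV a b 0) = 1"
    using card_lattice_points[of 0] by simp
  then show ?thesis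
    unfolding ehrhart_series_def cut_series_def card_lattice_points by (auto intro!: fps_ext)
qed

lemma degree_h_star_polytope: "degree (h_star \<C>) = CARD('e)"
proof -
  obtain h where h: "fps_of_poly h = cut_series UNIV UNIV a b * (1 - fps_X) ^ (CARD('v) + CARD('e))"
      "0 < coeff h CARD('e)" "degree h \<le> CARD('e)"
    using cut_series_numerator[of UNIV UNIV a b] by auto
  have "fps_nth ((1 - fps_X) ^ (CARD('v) + CARD('e)) :: real fps) 0 \<noteq> 0"
    by (simp add: fps_power_zeroth)
  then have "(1 - fps_X) ^ (CARD('v) + CARD('e)) \<noteq> (0 :: real fps)"
    by auto
  then have "ehrhart_series \<C> = fps_of_poly h / (1 - fps_X) ^ (CARD('v) + CARD('e))"
    unfolding ehrhart_series_polytope h(1) by simp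
  moreover have "nat (aff_dim \<C> + 1) = CARD('v) + CARD('e)"
    unfolding aff_dim_polytope by simp
  ultimately have "h_star \<C> = h"
    by (intro h_star_eqI) simp
  \<comment> \<open>The positive coefficient at \<open>CARD('e)\<close> makes the degree bound
    sharp.\<close>
  then show ?thesis
    using h(2,3) le_degree[of h "CARD('e)"] by simp
qed

end

theorem theorem3p11:
  fixes ends :: "'e::finite \<Rightarrow> ('v::finite) uprod"
  assumes "no_isolated_vertices ends"
  shows "codegree (cosmological_polytope ends) = CARD('v)
    \<and> degree (h_star (cosmological_polytope ends)) = CARD('e)"
proof -
  \<comment> \<open>Chooses an arbitrary orientation of every edge.\<close>
  have "\<forall>f. \<exists>p. ends f = Upair (fst p) (snd p)"
    by (metis fst_conv snd_conv uprod_exhaust)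
  then obtain p where "\<And>f. ends f = Upair (fst (p f)) (snd (p f))"
    by metis
  from codegree_polytope[OF this assms] degree_h_star_polytope[OF this assms] show ?thesis ..
qed

end
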